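(* Let $\mathfrak{g}$ be a complex semisimple Lie algebra with Cartan matrix $\|a_{ij}\|_{i,j\in I}$, let $W_G$ be its Weyl group, and let $W_G^U$ be the group defined in the context. Then $W_G^U$ is an extension $$1\longrightarrow \mathbb{Z}_2^{|I|}\longrightarrow W_G^U\longrightarrow W_G\longrightarrow 1$$ of the Weyl group $W_G$ by an abelian subgroup $\mathbb{Z}_2^{|I|}\subset W_G^U$; that is, there is such a short exact sequence of groups.
   Context: $I$ is the set of vertices of the Dynkin diagram of $\mathfrak{g}=\mathrm{Lie}(G)$, $a_{ij}=\langle\alpha_i^\vee,\alpha_j\rangle$ for simple roots $\alpha_i$ and simple co-roots $\alpha_i^\vee$, and $m_{ij}=2,3,4,6$ for $a_{ij}a_{ji}=0,1,2,3$ respectively ($i\ne j$). The Weyl group $W_G$ is generated by simple reflections $s_i$, $i\in I$, subject to $s_i^2=1$ and $\underbrace{s_is_js_i\cdots}_{m_{ij}}=\underbrace{s_js_is_j\cdots}_{m_{ij}}$ for $i\ne j$. Here $\mathbb{Z}_2=\mathbb{Z}/2\mathbb{Z}$. $W_G^U$ is the group generated by $\{\sigma_i,\bar\sigma_i: i\in I\}$ subject to the relations $\sigma_i^2=\bar\sigma_i^2=1$, $\sigma_i\bar\sigma_i=\bar\sigma_i\sigma_i$ for $i\in I$; and, for $i\neq j$ in $I$, $$\sigma_j\sigma_i\sigma_j=\bar\sigma_j\,\Pi^{1-a_{ji}}(\bar\sigma_i)\,\bar\sigma_j,\qquad \underbrace{\sigma_i\sigma_j\sigma_i\cdots}_{m_{ij}}=\underbrace{\bar\sigma_j\bar\sigma_i\bar\sigma_j\cdots}_{m_{ij}},$$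 where each side of the last relation is an alternating product of $m_{ij}$ factors, and $\Pi$ is the involutive map of generators $\Pi(\sigma_i)=\bar\sigma_i$, $\Pi(\bar\sigma_i)=\sigma_i$. *)

theory Defs
  imports Complex_Main "HOL-Algebra.Product_Groups"
begin

section \<open>Complex semisimple Lie algebras and their Cartan matrices\<close>

locale complex_lie_algebra = vector_space scale
  for scale :: "complex \<Rightarrow> 'g::ab_group_add \<Rightarrow> 'g" +
  fixes br :: "'g \<Rightarrow> 'g \<Rightarrow> 'g"
  assumes finite_dimensional: "\<exists>B. finite B \<and> span B = UNIV"
    and br_add_left: "br (x + y) z = br x z + br y z"
    and br_add_right: "br x (y + z) = br x y + br x z"
    and br_scale_left: "br (scale c x) y = scale c (br x y)"
    and br_scale_right: "br x (scale c y) = scale c (br x y)"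
    and br_self: "br x x = 0"
    and jacobi: "br x (br y z) + br y (br z x) + br z (br x y) = 0"
begin

definition lie_ideal :: "'g set \<Rightarrow> bool" where
  "lie_ideal J \<longleftrightarrow> subspace J \<and> (\<forall>x. \<forall>y\<in>J. br x y \<in> J)"

definition derived :: "'g set \<Rightarrow> 'g set" where
  "derived J = span {br x y | x y. x \<in> J \<and> y \<in> J}"

definition solvable_set :: "'g set \<Rightarrow> bool" where
  "solvable_set J \<longleftrightarrow> (\<exists>n. (derived ^^ n) J = {0})"

text \<open>Semisimplicity as vanishing of the radical; in particular the zero algebra is semisimple.\<close>

definition semisimple :: bool where
  "semisimple \<longleftrightarrow> (\<forall>J. lie_ideal J \<and> solvable_set J \<longrightarrow> J = {0})"

text \<open>Cartan subalgebras of a semisimple complex Lie algebra: abelian, equal to their own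
  centralizer (i.e. maximal abelian), and acting diagonalizably in the adjoint representation.\<close>

definition cartan_subalgebra :: "'g set \<Rightarrow> bool" where
  "cartan_subalgebra H \<longleftrightarrow>
     subspace H \<and>
     (\<forall>x\<in>H. \<forall>y\<in>H. br x y = 0) \<and>
     (\<forall>x. (\<forall>h\<in>H. br h x = 0) \<longrightarrow> x \<in> H) \<and>
     (\<forall>h\<in>H. span {x. \<exists>c. br h x = scale c x} = UNIV)"

definition root_space :: "'g set \<Rightarrow> ('g \<Rightarrow> complex) \<Rightarrow> 'g set" where
  "root_space H \<alpha> = {x. \<forall>h\<in>H. br h x = scale (\<alpha> h) x}"

text \<open>A linear functional on \<open>H\<close> is represented by a function on the whole type that is
  linear on \<open>H\<close> and, to make the representation unique, zero outside \<open>H\<close>.\<close>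

definition functional_on :: "'g set \<Rightarrow> ('g \<Rightarrow> complex) \<Rightarrow> bool" where
  "functional_on H \<alpha> \<longleftrightarrow>
     (\<forall>x\<in>H. \<forall>y\<in>H. \<alpha> (x + y) = \<alpha> x + \<alpha> y) \<and>
     (\<forall>c. \<forall>x\<in>H. \<alpha> (scale c x) = c * \<alpha> x) \<and>
     (\<forall>x. x \<notin> H \<longrightarrow> \<alpha> x = 0)"

definition is_root :: "'g set \<Rightarrow> ('g \<Rightarrow> complex) \<Rightarrow> bool" where
  "is_root H \<alpha> \<longleftrightarrow>
     functional_on H \<alpha> \<and> (\<exists>h\<in>H. \<alpha> h \<noteq> 0) \<and> root_space H \<alpha> \<noteq> {0}"

text \<open>A system of simple roots (base of the root system), indexed without repetition by \<open>I\<close>.\<close>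

definition simple_roots :: "'g set \<Rightarrow> 'i set \<Rightarrow> ('i \<Rightarrow> 'g \<Rightarrow> complex) \<Rightarrow> bool" where
  "simple_roots H I \<alpha> \<longleftrightarrow>
     finite I \<and>
     (\<forall>i\<in>I. is_root H (\<alpha> i)) \<and>
     (\<forall>c. (\<forall>h\<in>H. (\<Sum>i\<in>I. c i * \<alpha> i h) = 0) \<longrightarrow> (\<forall>i\<in>I. c i = 0)) \<and>
     (\<forall>\<beta>. is_root H \<beta> \<longrightarrow>
        (\<exists>n :: 'i \<Rightarrow> nat.
           (\<forall>h\<in>H. \<beta> h = (\<Sum>i\<in>I. of_nat (n i) * \<alpha> i h)) \<or>
           (\<forall>h\<in>H. \<beta> h = - (\<Sum>i\<in>I. of_nat (n i) * \<alpha> i h))))"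

text \<open>The co-root of \<open>\<alpha>\<close> is the element \<open>t\<close> of the line spanned by the brackets of
  root vectors for \<open>\<alpha>\<close> and \<open>-\<alpha>\<close> that is normalized by \<open>\<alpha> t = 2\<close>.\<close>

definition is_coroot :: "'g set \<Rightarrow> ('g \<Rightarrow> complex) \<Rightarrow> 'g \<Rightarrow> bool" where
  "is_coroot H \<alpha> t \<longleftrightarrow>
     t \<in> span {br x y | x y. x \<in> root_space H \<alpha> \<and> y \<in> root_space H (\<lambda>h. - \<alpha> h)} \<and>
     \<alpha> t = 2"

text \<open>\<open>a i j\<close> is the pairing of the co-root of \<open>i\<close> with the root of \<open>j\<close>; only its values
  on \<open>I\<close> matter.\<close>

definition is_cartan_matrix :: "'i set \<Rightarrow> ('i \<Rightarrow> 'i \<Rightarrow> int) \<Rightarrow> bool" where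
  "is_cartan_matrix I a \<longleftrightarrow>
     (\<exists>H \<alpha> \<alpha>v.
        cartan_subalgebra H \<and> simple_roots H I \<alpha> \<and>
        (\<forall>i\<in>I. is_coroot H (\<alpha> i) (\<alpha>v i)) \<and>
        (\<forall>i\<in>I. \<forall>j\<in>I. \<alpha> j (\<alpha>v i) = of_int (a i j)))"

end


section \<open>Groups given by generators and relations\<close>

text \<open>Group words over \<open>S\<close>: the letter \<open>(s, True)\<close> stands for \<open>s\<close> and \<open>(s, False)\<close> for
  its inverse.\<close>

definition group_words :: "'a set \<Rightarrow> ('a \<times> bool) list set" where
  "group_words S = lists (S \<times> UNIV)"

text \<open>The least congruence on words containing the free cancellations and the relations
  \<open>u = v\<close> for \<open>(u, v) \<in> R\<close>.\<close>

inductive word_eq ::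
  "'a set \<Rightarrow> (('a \<times> bool) list \<times> ('a \<times> bool) list) set \<Rightarrow>
   ('a \<times> bool) list \<Rightarrow> ('a \<times> bool) list \<Rightarrow> bool"
  for S R where
  refl: "u \<in> group_words S \<Longrightarrow> word_eq S R u u"
| sym: "word_eq S R u v \<Longrightarrow> word_eq S R v u"
| trans: "word_eq S R u v \<Longrightarrow> word_eq S R v w \<Longrightarrow> word_eq S R u w"
| append: "word_eq S R u v \<Longrightarrow> word_eq S R u' v' \<Longrightarrow> word_eq S R (u @ u') (v @ v')"
| cancel: "s \<in> S \<Longrightarrow> word_eq S R [(s, b), (s, \<not> b)] []"
| rel: "(u, v) \<in> R \<Longrightarrow> u \<in> group_words S \<Longrightarrow> v \<in> group_words S \<Longrightarrow> word_eq S R u v"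

definition presented_group ::
  "'a set \<Rightarrow> (('a \<times> bool) list \<times> ('a \<times> bool) list) set \<Rightarrow> ('a \<times> bool) list set monoid" where
  "presented_group S R =
     \<lparr>carrier = group_words S // {(u, v). word_eq S R u v},
      monoid.mult = (\<lambda>X Y. {w. \<exists>u\<in>X. \<exists>v\<in>Y. word_eq S R (u @ v) w}),
      one = {w. word_eq S R [] w}\<rparr>"

definition pos_word :: "'a list \<Rightarrow> ('a \<times> bool) list" where
  "pos_word xs = map (\<lambda>x. (x, True)) xs"

definition pos_relations :: "('a list \<times> 'a list) set \<Rightarrow> (('a \<times> bool) list \<times> ('a \<times> bool) list) set" where
  "pos_relations R = (\<lambda>(u, v). (pos_word u, pos_word v)) ` R"

fun alternating :: "nat \<Rightarrow> 'a \<Rightarrow> 'a \<Rightarrow> 'a list" where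
  "alternating 0 x y = []"
| "alternating (Suc m) x y = x # alternating m y x"


section \<open>The Weyl group and the group \<open>W\<^sub>G\<^sup>U\<close>\<close>

text \<open>For a Cartan matrix of a semisimple Lie algebra and distinct \<open>i\<close>, \<open>j\<close> in the index
  set, the product is one of 0, 1, 2, 3.\<close>

definition braid_length :: "('i \<Rightarrow> 'i \<Rightarrow> int) \<Rightarrow> 'i \<Rightarrow> 'i \<Rightarrow> nat" where
  "braid_length a i j =
     (let p = a i j * a j i in if p = 0 then 2 else if p = 1 then 3 else if p = 2 then 4 else 6)"

definition weyl_group :: "'i set \<Rightarrow> ('i \<Rightarrow> 'i \<Rightarrow> int) \<Rightarrow> ('i \<times> bool) list set monoid" where
  "weyl_group I a = presented_group I (pos_relations
     ({([i, i], []) | i. i \<in> I} \<union>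
      {(alternating (braid_length a i j) i j, alternating (braid_length a i j) j i) | i j.
         i \<in> I \<and> j \<in> I \<and> i \<noteq> j}))"

datatype 'i ugen = Sig 'i | SigBar 'i

fun swap_bar :: "'i ugen \<Rightarrow> 'i ugen" where
  "swap_bar (Sig i) = SigBar i"
| "swap_bar (SigBar i) = Sig i"

text \<open>The exponent \<open>1 - a j i\<close> is positive for \<open>i \<noteq> j\<close>, off-diagonal entries of a Cartan
  matrix being nonpositive, so \<open>nat\<close> loses nothing.\<close>

definition weyl_group_U :: "'i set \<Rightarrow> ('i \<Rightarrow> 'i \<Rightarrow> int) \<Rightarrow> ('i ugen \<times> bool) list set monoid" where
  "weyl_group_U I a = presented_group (Sig ` I \<union> SigBar ` I) (pos_relations
     ({([Sig i, Sig i], []) | i. i \<in> I} \<union>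
      {([SigBar i, SigBar i], []) | i. i \<in> I} \<union>
      {([Sig i, SigBar i], [SigBar i, Sig i]) | i. i \<in> I} \<union>
      {([Sig j, Sig i, Sig j],
        [SigBar j, (swap_bar ^^ nat (1 - a j i)) (SigBar i), SigBar j]) | i j.
         i \<in> I \<and> j \<in> I \<and> i \<noteq> j} \<union>
      {(alternating (braid_length a i j) (Sig i) (Sig j),
        alternating (braid_length a i j) (SigBar j) (SigBar i)) | i j.
         i \<in> I \<and> j \<in> I \<and> i \<noteq> j}))"


section \<open>Short exact sequences\<close>

text \<open>The library's \<open>short_exact_sequence\<close> requires all three groups to have elements of
  the same type, hence this heterogeneous version of \<open>1 \<rightarrow> A \<rightarrow> B \<rightarrow> C \<rightarrow> 1\<close>.\<close>

definition short_exact ::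
  "'a monoid \<Rightarrow> 'b monoid \<Rightarrow> 'c monoid \<Rightarrow> ('a \<Rightarrow> 'b) \<Rightarrow> ('b \<Rightarrow> 'c) \<Rightarrow> bool" where
  "short_exact A B C \<iota> \<pi> \<longleftrightarrow>
     group A \<and> group B \<and> group C \<and>
     \<iota> \<in> mon A B \<and> \<pi> \<in> epi B C \<and> \<iota> ` carrier A = kernel B C \<pi>"

end

theory Submission
  imports Defs
begin

text \<open>
  Put \<open>\<eta>\<^sub>i = \<sigma>\<^sub>i \<sigma>'\<^sub>i\<close>, where \<open>\<sigma>'\<^sub>i\<close> is the barred generator. The relations say that the \<open>\<eta>\<^sub>i\<close> are
  commuting involutions and that \<open>\<sigma>\<^sub>i \<eta>\<^sub>j \<sigma>\<^sub>i\<close> is \<open>\<eta>\<^sub>i \<eta>\<^sub>j\<close> or \<open>\<eta>\<^sub>j\<close> according to the parity of \<open>a\<^sub>j\<^sub>i\<close>, so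
  they generate a normal subgroup, and setting \<open>\<eta>\<^sub>i = 1\<close> leaves the Coxeter presentation of the Weyl group. The point is that the
  \<open>\<eta>\<^sub>i\<close> are independent. To see this, let \<open>\<eta>\<^sub>i\<close> act on pairs (Weyl group element \<open>w\<close>, vector \<open>v\<close> in
  the coroot lattice modulo 2) by adding \<open>w \<alpha>\<^sub>i\<^sup>\<or>\<close> to \<open>v\<close>, and \<open>\<sigma>\<^sub>i\<close> by \<open>w \<mapsto> w s\<^sub>i\<close>, adding the same vector
  exactly when \<open>\<plusminus> w \<alpha>\<^sub>i\<close> is negative, with sign given by the parity of \<open>w\<close>. This is Tits' cocycle
  twisted by \<open>\<rho>\<close>, and the only property of negativity it needs is that exactly one of \<open>x\<close>, \<open>-x\<close>
  is negative, so no positive system has to be constructed.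

  The Lie algebra enters only through the list of possible pairs \<open>(a\<^sub>i\<^sub>j, a\<^sub>j\<^sub>i)\<close>. It follows from
  traces over weight strings, which vanish on commutators, together with the strict Cauchy-Schwarz
  inequality for the trace form on the coroots.
\<close>

section \<open>Cartan integers of a semisimple Lie algebra\<close>

context complex_lie_algebra
begin

lemma br_zero_right [simp]: "br x 0 = 0"
  using br_add_right[of x 0 0] by simp

lemma br_zero_left [simp]: "br 0 x = 0"
  using br_add_left[of 0 0 x] by simp

lemma br_anticomm: "br y x = - br x y"
proof -
  have "br (x + y) (x + y) = (br x x + br x y) + (br y x + br y y)"
    by (simp only: br_add_left br_add_right ac_simps)
  then have "br y x + br x y = 0" by (simp add: br_self add.commute)
  then show ?thesis by (simp only: eq_neg_iff_add_eq_0)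
qed

lemma linear_br: "Vector_Spaces.linear scale scale (br x)"
  by (simp add: linear_iff_module_hom module_hom_iff module_axioms br_add_right br_scale_right)

lemma br_sum_right: "br x (sum f S) = (\<Sum>i\<in>S. br x (f i))"
  by (induction S rule: infinite_finite_induct) (auto simp: br_add_right)

lemma br_minus_right: "br x (- y) = - br x y"
  by (metis add.right_inverse br_add_right br_zero_right eq_neg_iff_add_eq_0 add.commute)

lemma br_diff_right: "br x (y - z) = br x y - br x z"
  using br_add_right[of x y "- z"] by (simp add: br_minus_right)

lemma br_br: "br (br x y) z = br x (br y z) - br y (br x z)"
proof -
  have "br z x = - br x z" "br z (br x y) = - br (br x y) z" by (rule br_anticomm)+
  with jacobi[of x y z] show ?thesis
    by (simp add: br_minus_right algebra_simps)
qed

text \<open>Applying \<open>br d\<close> minus the scalar \<open>p\<close> kills the component at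
  \<open>p\<close> and multiplies every other component by a nonzero factor \<open>c - p\<close>.
  Induction recovers the others, and subtraction then recovers \<open>y p\<close>.\<close>

lemma invariant_subspace_eigencomponent:
  assumes M: "subspace M" and T: "\<And>v. v \<in> M \<Longrightarrow> br d v \<in> M"
    and "finite F" and "\<And>c. c \<in> F \<Longrightarrow> br d (y c) = scale c (y c)" and "(\<Sum>c\<in>F. y c) \<in> M"
  shows "\<forall>c\<in>F. y c \<in> M"
  using assms(3-5)
proof (induction F arbitrary: y rule: finite_induct)
  case (insert p F)
  have M': "br d (\<Sum>c\<in>insert p F. y c) - scale p (\<Sum>c\<in>insert p F. y c) \<in> M"
    using insert.prems T M by (simp add: subspace_diff subspace_scale)
  have "br d (\<Sum>c\<in>insert p F. y c) = (\<Sum>c\<in>insert p F. scale c (y c))"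
    using insert.prems(1) by (simp only: br_sum_right) (rule sum.cong, auto)
  then have "br d (\<Sum>c\<in>insert p F. y c) - scale p (\<Sum>c\<in>insert p F. y c)
      = (\<Sum>c\<in>F. scale (c - p) (y c))"
    using insert.hyps by (simp add: scale_sum_right scale_left_diff_distrib sum_subtractf scale_right_distrib)
  then have "\<forall>c\<in>F. scale (c - p) (y c) \<in> M"
    using M' insert.prems(1) by (intro insert.IH) (auto simp: br_scale_right)
  then have yF: "\<forall>c\<in>F. y c \<in> M"
    using insert.hyps M
    by (metis (no_types, lifting) right_minus_eq scale_one scale_scale subspace_scale left_inverse)
  then have "(\<Sum>c\<in>F. y c) \<in> M" using M by (simp add: subspace_sum)
  then have "(\<Sum>c\<in>insert p F. y c) - (\<Sum>c\<in>F. y c) \<in> M"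
    using insert.prems(2) M by (intro subspace_diff)
  then show ?case using yF insert.hyps by simp
qed simp

text \<open>Collecting the summands by eigenvalue makes the eigenvalues distinct, which is the form
  that \<open>invariant_subspace_eigencomponent\<close> takes.\<close>

lemma span_eigenvectors_eq_sum:
  assumes "x \<in> span {x. \<exists>c. br d x = scale c x}"
  shows "\<exists>F y. finite F \<and> (\<forall>c. br d (y c) = scale c (y c)) \<and> x = (\<Sum>c\<in>F. y c)"
  using assms
proof (induction rule: span_induct_alt)
  case base
  show ?case by (intro exI[of _ "{}"] exI[of _ "\<lambda>_. 0"]) auto
next
  case (step k x z)
  then obtain p F y where p: "br d x = scale p x" and F: "finite F"
    "\<And>c. br d (y c) = scale c (y c)" "z = (\<Sum>c\<in>F. y c)" by auto
  \<comment> \<open>Outside \<open>F\<close> the values of \<open>y\<close> are eigenvectors but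
    need not vanish, so they are cut off before the new term joins the component at
    \<open>p\<close>.\<close>
  define y' where "y' c = (if c \<in> F then y c else 0) + (if c = p then scale k x else 0)" for c
  have "(\<Sum>c\<in>insert p F. y' c) = (\<Sum>c\<in>insert p F. if c \<in> F then y c else 0) + scale k x"
    using F(1) by (simp add: y'_def sum.distrib)
  also have "(\<Sum>c\<in>insert p F. if c \<in> F then y c else 0) = (\<Sum>c\<in>F. y c)"
    using F(1) by (intro sum.mono_neutral_cong_right) auto
  finally have "scale k x + z = (\<Sum>c\<in>insert p F. y' c)" using F by (simp add: add.commute)
  moreover have "\<forall>c. br d (y' c) = scale c (y' c)"
    using F p by (auto simp: y'_def br_add_right br_scale_right scale_right_distrib)
  ultimately show ?case using F(1) by (intro exI[of _ "insert p F"] exI[of _ y']) auto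
qed

text \<open>A joint eigenvector for \<open>D\<close> splits into eigenvectors of the new element
  \<open>d\<close>. Each piece keeps the old eigenvalues, because \<open>d\<close> commutes with
  \<open>D\<close> and so \<open>br d\<close> preserves the joint eigenspaces of
  \<open>D\<close>.\<close>

lemma span_joint_eigenvectors:
  assumes H: "cartan_subalgebra H" and "finite D" "D \<subseteq> H"
  shows "span {x. \<forall>h\<in>D. \<exists>c. br h x = scale c x} = UNIV"
  using assms(2,3)
proof (induction D rule: finite_induct)
  case (insert d D)
  let ?E = "\<lambda>D. {x. \<forall>h\<in>D. \<exists>c. br h x = scale c x}"
  have "?E D \<subseteq> span (?E (insert d D))"
  proof
    fix x assume "x \<in> ?E D"
    then obtain w where w: "\<And>h. h \<in> D \<Longrightarrow> br h x = scale (w h) x" by simp metis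
    have "x \<in> span {x. \<exists>c. br d x = scale c x}"
      using H insert.prems by (auto simp: cartan_subalgebra_def)
    then obtain F y where F: "finite F" and y: "\<And>c. br d (y c) = scale c (y c)"
      and x: "x = (\<Sum>c\<in>F. y c)" using span_eigenvectors_eq_sum by metis
    let ?M = "{v. \<forall>h\<in>D. br h v = scale (w h) v}"
    have M: "subspace ?M"
      by (auto simp: subspace_def br_add_right br_scale_right scale_right_distrib mult.commute)
    have T: "br d v \<in> ?M" if "v \<in> ?M" for v
    proof clarify
      fix h assume h: "h \<in> D"
      have "br h d = 0" using H h insert.prems by (auto simp: cartan_subalgebra_def)
      then have "br h (br d v) = br d (br h v)" using br_br[of h d v] by simp
      then show "br h (br d v) = scale (w h) (br d v)" using that h by (simp add: br_scale_right)
    qed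
    have "\<forall>c\<in>F. y c \<in> ?M"
      by (rule invariant_subspace_eigencomponent[OF M T F y]) (use w x in auto)
    then have "\<forall>c\<in>F. y c \<in> ?E (insert d D)" using y by blast
    then show "x \<in> span (?E (insert d D))" unfolding x by (intro span_sum span_base) auto
  qed
  then have "span (?E D) \<subseteq> span (?E (insert d D))" by (simp add: span_minimal)
  then show ?case using insert.IH insert.prems by (simp add: top.extremum_unique)
qed simp

end

text \<open>Several members of \<open>B\<close> may share a weight, so dimensions of root spaces
  never enter. The value zero outside \<open>H\<close> is the normalization of
  \<open>functional_on\<close>.\<close>

locale cartan_eigenbasis = complex_lie_algebra scale br
  for scale :: "complex \<Rightarrow> 'g::ab_group_add \<Rightarrow> 'g" and br +
  fixes H B :: "'g set" and wt :: "'g \<Rightarrow> 'g \<Rightarrow> complex"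
  assumes cartan: "cartan_subalgebra H"
    and finite_B: "finite B" and independent_B: "independent B" and span_B: "span B = UNIV"
    and br_basis: "b \<in> B \<Longrightarrow> h \<in> H \<Longrightarrow> br h b = scale (wt b h) b"
    and wt_outside: "h \<notin> H \<Longrightarrow> wt b h = 0"

text \<open>The joint eigenvectors for a finite basis of \<open>H\<close> span everything. By
  linearity they are eigenvectors for all of \<open>H\<close>, and a spanning set contains a
  basis.\<close>

lemma (in complex_lie_algebra) cartan_eigenbasis_exists:
  assumes H: "cartan_subalgebra H"
  shows "\<exists>B wt. cartan_eigenbasis scale br H B wt"
proof -
  obtain D where D: "D \<subseteq> H" "independent D" "H \<subseteq> span D" using basis_exists by metis
  obtain T where T: "finite T" "span T = UNIV" using finite_dimensional by auto
  have fin: "finite X" if "independent X" for X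
    using independent_span_bound[OF T(1) that] T by auto
  have "{x. \<forall>h\<in>D. \<exists>c. br h x = scale c x} \<subseteq> {x. \<forall>h\<in>H. \<exists>c. br h x = scale c x}"
  proof clarify
    fix x h assume x: "\<forall>h\<in>D. \<exists>c. br h x = scale c x" and "h \<in> H"
    have "h \<in> span D" using \<open>h \<in> H\<close> D by auto
    then show "\<exists>c. br h x = scale c x"
    proof (induction rule: span_induct_alt)
      case base
      show ?case by (auto intro: exI[of _ 0])
    next
      case (step k u v)
      then obtain p q where "br u x = scale p x" "br v x = scale q x" using x by metis
      then have "br (scale k u + v) x = scale (k * p + q) x"
        by (simp add: br_add_left br_scale_left scale_left_distrib)
      then show ?case ..
    qed
  qed
  moreover define E where "E = {x. \<forall>h\<in>H. \<exists>c. br h x = scale c x}"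
  ultimately have "span {x. \<forall>h\<in>D. \<exists>c. br h x = scale c x} \<subseteq> span E"
    by (intro span_mono) simp
  then have E: "span E = UNIV"
    unfolding span_joint_eigenvectors[OF H fin[OF D(2)] D(1)] by (rule top.extremum_uniqueI)
  obtain B where B: "B \<subseteq> E" "independent B" "E \<subseteq> span B" using basis_exists by metis
  have "span E \<subseteq> span B" by (rule span_minimal[OF B(3) subspace_span])
  then have span: "span B = UNIV" unfolding E by (rule top.extremum_uniqueI)
  define wt where "wt b h = (if h \<in> H then SOME c. br h b = scale c b else 0)" for b h
  have "br h b = scale (wt b h) b" if "b \<in> B" "h \<in> H" for b h
  proof -
    have "\<exists>c. br h b = scale c b" using that B(1) by (auto simp: E_def)
    from someI_ex[OF this] show ?thesis using that(2) by (simp add: wt_def)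
  qed
  then have "cartan_eigenbasis scale br H B wt"
    using H B(2) span fin by unfold_locales (auto simp: wt_def)
  then show ?thesis by blast
qed

section \<open>Coordinates, block traces and weight strings in an eigenbasis\<close>

context cartan_eigenbasis
begin

abbreviation coord :: "'g \<Rightarrow> 'g \<Rightarrow> complex" where
  "coord \<equiv> representation B"

lemma coord_add: "coord (x + y) b = coord x b + coord y b"
  using representation_add[OF independent_B, of y x] span_B by simp

lemma coord_diff: "coord (x - y) b = coord x b - coord y b"
  using representation_diff[OF independent_B, of y x] span_B by simp

lemma coord_scale: "coord (scale c x) b = c * coord x b"
  using representation_scale[OF independent_B, of x c] span_B by simp

lemma coord_basis: "b \<in> B \<Longrightarrow> coord b c = (if c = b then 1 else 0)"
  using representation_basis[OF independent_B, of b] by simp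

lemma sum_coord: "(\<Sum>b\<in>B. scale (coord x b) b) = x"
  using sum_representation_eq[OF independent_B] span_B finite_B by auto

lemma coord_linear:
  assumes "Vector_Spaces.linear scale scale f"
  shows "coord (f x) b = (\<Sum>c\<in>B. coord x c * coord (f c) b)"
proof -
  interpret f: Vector_Spaces.linear scale scale f by fact
  have "f x = f (\<Sum>c\<in>B. scale (coord x c) c)" by (simp add: sum_coord)
  also have "\<dots> = (\<Sum>c\<in>B. scale (coord x c) (f c))"
    by (simp add: f.sum f.scale)
  finally show ?thesis
    using representation_sum[OF independent_B, of B "\<lambda>c. scale (coord x c) (f c)"] span_B
    by (simp add: coord_scale)
qed

text \<open>The coordinate of \<open>br h x\<close> at \<open>b\<close> is both
  \<open>\<mu> h\<close> times and \<open>wt b h\<close> times that of \<open>x\<close>, which is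
  nonzero.\<close>

lemma coord_weight:
  assumes x: "\<And>h. h \<in> H \<Longrightarrow> br h x = scale (\<mu> h) x" and b: "coord x b \<noteq> 0" and h: "h \<in> H"
  shows "wt b h = \<mu> h"
proof -
  have bB: "b \<in> B" using b representation_ne_zero by blast
  have "\<mu> h * coord x b = coord (br h x) b" by (simp add: x h coord_scale)
  also have "\<dots> = (\<Sum>c\<in>B. coord x c * coord (br h c) b)" by (rule coord_linear[OF linear_br])
  also have "\<dots> = (\<Sum>c\<in>B. if c = b then coord x b * wt b h else 0)"
    by (rule sum.cong) (auto simp: br_basis h coord_scale coord_basis)
  also have "\<dots> = coord x b * wt b h" using finite_B bB by simp
  finally show ?thesis using b by simp
qed

text \<open>For \<open>S\<close> inside \<open>B\<close> this is the trace of a diagonal block of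
  the matrix. For linear \<open>f\<close> with \<open>stable S f\<close> it is the trace of the
  restriction to \<open>span S\<close>.\<close>

definition trace_on :: "'g set \<Rightarrow> ('g \<Rightarrow> 'g) \<Rightarrow> complex" where
  "trace_on S f = (\<Sum>b\<in>S. coord (f b) b)"

definition stable :: "'g set \<Rightarrow> ('g \<Rightarrow> 'g) \<Rightarrow> bool" where
  "stable S f \<longleftrightarrow> (\<forall>b\<in>S. \<forall>c. coord (f b) c \<noteq> 0 \<longrightarrow> c \<in> S)"

text \<open>Stability of the inner map confines the matrix product to indices in \<open>S\<close>;
  exchanging the two summations then gives the identity.\<close>

lemma trace_on_comm:
  assumes S: "S \<subseteq> B" and f: "Vector_Spaces.linear scale scale f" "stable S f"
    and g: "Vector_Spaces.linear scale scale g" "stable S g"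
  shows "trace_on S (\<lambda>x. f (g x)) = trace_on S (\<lambda>x. g (f x))"
proof -
  have *: "trace_on S (\<lambda>x. f (g x)) = (\<Sum>b\<in>S. \<Sum>c\<in>S. coord (g b) c * coord (f c) b)"
    if "Vector_Spaces.linear scale scale f" "stable S g" for f g
    unfolding trace_on_def
  proof (rule sum.cong[OF HOL.refl])
    fix b assume "b \<in> S"
    then show "coord (f (g b)) b = (\<Sum>c\<in>S. coord (g b) c * coord (f c) b)"
      unfolding coord_linear[OF that(1), of "g b"]
      using that(2) S finite_B by (intro sum.mono_neutral_right) (auto simp: stable_def)
  qed
  show ?thesis
    unfolding *[OF f(1) g(2)] *[OF g(1) f(2)]
    by (subst sum.swap) (simp only: mult.commute)
qed

lemma stable_B: "stable B f"
  unfolding stable_def using representation_ne_zero by blast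

lemma trace_on_diff: "trace_on S (\<lambda>x. f x - g x) = trace_on S f - trace_on S g"
  by (simp add: trace_on_def coord_diff sum_subtractf)

lemma trace_on_br:
  assumes "S \<subseteq> B" "h \<in> H"
  shows "trace_on S (br h) = (\<Sum>b\<in>S. wt b h)"
  unfolding trace_on_def
proof (rule sum.cong[OF HOL.refl])
  fix b assume "b \<in> S"
  then have "b \<in> B" using assms by blast
  then show "coord (br h b) b = wt b h" using assms(2) by (simp add: br_basis coord_scale coord_basis)
qed

text \<open>Root vectors move weights by \<plusminus>\<alpha>, so this condition makes
  \<open>span S\<close> invariant under them.\<close>

definition shift_closed :: "'g set \<Rightarrow> ('g \<Rightarrow> complex) \<Rightarrow> bool" where
  "shift_closed S \<alpha> \<longleftrightarrow> S \<subseteq> B \<and>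
     (\<forall>b\<in>S. \<forall>c\<in>B. (\<forall>h\<in>H. wt c h = wt b h + \<alpha> h) \<or> (\<forall>h\<in>H. wt c h = wt b h - \<alpha> h) \<longrightarrow> c \<in> S)"

lemma br_root_vector_weight:
  assumes x: "x \<in> root_space H \<alpha>" and b: "b \<in> B" and h: "h \<in> H"
  shows "br h (br x b) = scale (wt b h + \<alpha> h) (br x b)"
proof -
  have "br h (br x b) = br (br h x) b + br x (br h b)" by (simp add: br_br)
  also have "br h x = scale (\<alpha> h) x" using x h by (simp add: root_space_def)
  also have "br h b = scale (wt b h) b" by (rule br_basis[OF b h])
  finally show ?thesis
    by (simp only: br_scale_left br_scale_right scale_left_distrib add.commute)
qed

lemma stable_root_vector:
  assumes "shift_closed S \<alpha>" and "x \<in> root_space H \<alpha> \<or> x \<in> root_space H (\<lambda>h. - \<alpha> h)"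
  shows "stable S (br x)"
  unfolding stable_def
proof (intro ballI allI impI)
  fix b c assume b: "b \<in> S" and c: "coord (br x b) c \<noteq> 0"
  have bB: "b \<in> B" using b assms(1) unfolding shift_closed_def by blast
  have cB: "c \<in> B" using c by (rule representation_ne_zero)
  from assms(2) have "(\<forall>h\<in>H. wt c h = wt b h + \<alpha> h) \<or> (\<forall>h\<in>H. wt c h = wt b h - \<alpha> h)"
  proof
    assume "x \<in> root_space H \<alpha>"
    then have "\<forall>h\<in>H. wt c h = wt b h + \<alpha> h"
      using coord_weight[where x = "br x b" and \<mu> = "\<lambda>h. wt b h + \<alpha> h", OF _ c] br_root_vector_weight bB by blast
    then show ?thesis ..
  next
    assume "x \<in> root_space H (\<lambda>h. - \<alpha> h)"
    then have "\<forall>h\<in>H. wt c h = wt b h + - \<alpha> h"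
      using coord_weight[where x = "br x b" and \<mu> = "\<lambda>h. wt b h + - \<alpha> h", OF _ c] br_root_vector_weight bB by blast
    then show ?thesis by simp
  qed
  then show "c \<in> S" using assms(1) b cB unfolding shift_closed_def by blast
qed

text \<open>The bracket has weight \<alpha> - \<alpha> = 0, and \<open>H\<close> is its own
  centralizer.\<close>

lemma br_opposite_root_vectors_in_cartan:
  assumes "x \<in> root_space H \<alpha>" "y \<in> root_space H (\<lambda>h. - \<alpha> h)"
  shows "br x y \<in> H"
proof -
  have "br h (br x y) = 0" if "h \<in> H" for h
  proof -
    have "br h (br x y) = br (br h x) y + br x (br h y)" by (simp add: br_br)
    then show ?thesis using assms that by (simp add: root_space_def br_scale_left br_scale_right br_minus_right)
  qed
  then show ?thesis using cartan by (auto simp: cartan_subalgebra_def)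
qed

lemma subspace_H: "subspace H"
  using cartan by (simp add: cartan_subalgebra_def)

lemma coroot_in_cartan:
  assumes "is_coroot H \<alpha> t"
  shows "t \<in> H"
  using assms span_minimal[OF _ subspace_H, of "{br x y | x y. x \<in> root_space H \<alpha> \<and> y \<in> root_space H (\<lambda>h. - \<alpha> h)}"]
    br_opposite_root_vectors_in_cartan by (fastforce simp: is_coroot_def)

text \<open>\<open>t\<close> is a combination of brackets of root vectors that preserve
  \<open>span S\<close>, and commutators have trace zero there. In the basis \<open>B\<close> the
  map \<open>br t\<close> is diagonal, so its trace is the sum of the weights.\<close>

lemma sum_weights_coroot:
  assumes t: "is_coroot H \<alpha> t" and S: "shift_closed S \<alpha>"
  shows "(\<Sum>b\<in>S. wt b t) = 0"
proof -
  have SB: "S \<subseteq> B" using S by (simp add: shift_closed_def)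
  have "t \<in> span {br x y | x y. x \<in> root_space H \<alpha> \<and> y \<in> root_space H (\<lambda>h. - \<alpha> h)}"
    using t by (simp add: is_coroot_def)
  then have "trace_on S (br t) = 0"
  proof (induction rule: span_induct_alt)
    case base
    show ?case by (simp add: trace_on_def representation_zero)
  next
    case (step c x y)
    then obtain u v where uv: "x = br u v" "u \<in> root_space H \<alpha>" "v \<in> root_space H (\<lambda>h. - \<alpha> h)" by auto
    have "trace_on S (br x) = 0"
      using trace_on_comm[OF SB linear_br _ linear_br, of u v] stable_root_vector[OF S] uv
      by (simp add: br_br[abs_def] trace_on_diff)
    then show ?case using step
      by (simp add: trace_on_def br_add_left br_scale_left coord_add coord_scale sum.distrib
          flip: sum_distrib_left)
  qed
  then show ?thesis using trace_on_br[OF SB coroot_in_cartan[OF t]] by simp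
qed

text \<open>Root vectors of \<open>\<alpha>\<close> and \<open>-\<alpha>\<close> shift the eigenvalue of \<open>t\<close> by the real number \<open>2\<close>, so all
  basis vectors whose eigenvalue has a given imaginary part form a shift-closed set.\<close>

lemma weight_coroot_real:
  assumes t: "is_coroot H \<alpha> t" and b: "b \<in> B"
  shows "wt b t \<in> \<real>"
proof -
  define S where "S = {c \<in> B. Im (wt c t) = Im (wt b t)}"
  have "shift_closed S \<alpha>"
    using t coroot_in_cartan[OF t] unfolding shift_closed_def S_def is_coroot_def by fastforce
  then have "(\<Sum>c\<in>S. Im (wt c t)) = 0"
    using sum_weights_coroot[OF t] by (metis Im_sum zero_complex.simps(2))
  moreover have "(\<Sum>c\<in>S. Im (wt c t)) = (\<Sum>c\<in>S. Im (wt b t))"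
    by (rule sum.cong) (auto simp: S_def)
  moreover have "finite S" "S \<noteq> {}" using finite_B b by (auto simp: S_def)
  ultimately show ?thesis by (simp add: complex_is_Real_iff)
qed

text \<open>The Killing form, with the trace taken in the basis \<open>B\<close>.\<close>

definition trace_form :: "'g \<Rightarrow> 'g \<Rightarrow> complex" where
  "trace_form x y = trace_on B (\<lambda>z. br x (br y z))"

lemma trace_form_cartan:
  assumes "x \<in> H" "y \<in> H"
  shows "trace_form x y = (\<Sum>b\<in>B. wt b x * wt b y)"
  unfolding trace_form_def trace_on_def using assms
  by (intro sum.cong) (auto simp: br_basis br_scale_right coord_scale coord_basis)

text \<open>By invariance the form at \<open>br u v\<close> and \<open>h\<close> equals the form at
  \<open>u\<close> and \<open>br v h\<close>, and \<open>br v h\<close> is \<open>\<alpha> h\<close>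
  times \<open>v\<close>.\<close>

lemma trace_form_coroot:
  assumes t: "is_coroot H \<alpha> t"
  shows "\<exists>c. \<forall>h\<in>H. trace_form t h = c * \<alpha> h"
proof -
  have "t \<in> span {br x y | x y. x \<in> root_space H \<alpha> \<and> y \<in> root_space H (\<lambda>h. - \<alpha> h)}"
    using t by (simp add: is_coroot_def)
  then show ?thesis
  proof (induction rule: span_induct_alt)
    case base
    show ?case by (intro exI[of _ 0]) (simp add: trace_form_def trace_on_def representation_zero)
  next
    case (step k x z)
    then obtain u v where uv: "x = br u v" "u \<in> root_space H \<alpha>" "v \<in> root_space H (\<lambda>h. - \<alpha> h)" by auto
    have x: "trace_form x h = trace_form u v * \<alpha> h" if "h \<in> H" for h
    proof -
      have "trace_form x h = trace_on B (\<lambda>z. br u (br v (br h z))) - trace_on B (\<lambda>z. br v (br u (br h z)))"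
        by (simp add: trace_form_def uv br_br trace_on_diff)
      also have "trace_on B (\<lambda>z. br v (br u (br h z))) = trace_on B (\<lambda>z. br u (br h (br v z)))"
        using trace_on_comm[OF subset_refl linear_br stable_B, of "\<lambda>z. br u (br h z)" v]
          Vector_Spaces.linear_compose[OF linear_br linear_br] stable_B by (simp add: o_def)
      also have "trace_on B (\<lambda>z. br u (br v (br h z))) - \<dots> = trace_on B (\<lambda>z. br u (br (br v h) z))"
        by (simp add: br_br trace_on_diff[symmetric] br_diff_right)
      also have "br v h = scale (\<alpha> h) v"
        using uv(3) that br_anticomm[of v h] by (simp add: root_space_def)
      finally show ?thesis
        by (simp add: trace_form_def trace_on_def br_scale_left br_scale_right coord_scale
            sum_distrib_left sum_distrib_right mult.commute)
    qed
    from step obtain c where "\<forall>h\<in>H. trace_form z h = c * \<alpha> h" by auto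
    moreover have "trace_form (scale k x + z) h = k * trace_form x h + trace_form z h" for h
      by (simp add: trace_form_def trace_on_def br_add_left br_scale_left coord_add coord_scale
          sum.distrib sum_distrib_left)
    ultimately show ?case
      using x by (intro exI[of _ "k * trace_form u v + c"]) (simp add: algebra_simps)
  qed
qed

lemma root_has_basis_vector:
  assumes "is_root H \<alpha>"
  shows "\<exists>b\<in>B. \<forall>h\<in>H. wt b h = \<alpha> h"
proof -
  have "0 \<in> root_space H \<alpha>" by (simp add: root_space_def)
  then obtain x where x: "x \<in> root_space H \<alpha>" "x \<noteq> 0"
    using assms unfolding is_root_def by blast
  then obtain b where b: "coord x b \<noteq> 0" using sum_coord[of x] by force
  then have "\<forall>h\<in>H. wt b h = \<alpha> h"
    using coord_weight[of x \<alpha>] x(1) by (simp add: root_space_def)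
  then show ?thesis using b representation_ne_zero by blast
qed

lemma weight_is_root:
  assumes b: "b \<in> B" and "\<exists>h\<in>H. wt b h \<noteq> 0"
  shows "is_root H (wt b)"
proof -
  have b0: "b \<noteq> 0" using b independent_B dependent_zero by auto
  have "wt b (x + y) = wt b x + wt b y" if "x \<in> H" "y \<in> H" for x y
  proof -
    have "scale (wt b (x + y)) b = scale (wt b x + wt b y) b"
      using that b subspace_H by (simp add: br_basis[symmetric] subspace_add br_add_left scale_left_distrib)
    then show ?thesis using b0 by (simp add: scale_right_imp_eq)
  qed
  moreover have "wt b (scale c x) = c * wt b x" if "x \<in> H" for c x
  proof -
    have "scale (wt b (scale c x)) b = scale (c * wt b x) b"
      using that b subspace_H by (simp add: br_basis[symmetric] subspace_scale br_scale_left
          flip: scale_scale)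
    then show ?thesis using b0 by (simp add: scale_right_imp_eq)
  qed
  moreover have "b \<in> root_space H (wt b)" using b by (simp add: root_space_def br_basis)
  ultimately show ?thesis
    using assms(2) b0 wt_outside by (auto simp: is_root_def functional_on_def)
qed

text \<open>The basis vectors with weight in \<open>\<alpha>\<^sub>j + \<int> \<alpha>\<^sub>i\<close> form a shift-closed set, on which only
  nonnegative multiples of \<open>\<alpha>\<^sub>i\<close> occur.\<close>

lemma simple_root_coroot_nonpos:
  fixes \<alpha> :: "'i \<Rightarrow> 'g \<Rightarrow> complex"
  assumes sr: "simple_roots H I \<alpha>" and i: "i \<in> I" and j: "j \<in> I" and ij: "i \<noteq> j"
    and t: "is_coroot H (\<alpha> i) t" and r: "\<alpha> j t = of_int r"
  shows "r \<le> 0"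
proof -
  define S where "S = {b \<in> B. \<exists>k::int. \<forall>h\<in>H. wt b h = \<alpha> j h + of_int k * \<alpha> i h}"
  have fin: "finite I" using sr by (simp add: simple_roots_def)
  have li: "\<forall>l\<in>I. c l = 0" if "\<forall>h\<in>H. (\<Sum>l\<in>I. c l * \<alpha> l h) = 0" for c
    using sr that by (simp add: simple_roots_def)
  have tH: "t \<in> H" by (rule coroot_in_cartan[OF t])
  have ait: "\<alpha> i t = 2" using t by (simp add: is_coroot_def)
  have sc: "shift_closed S (\<alpha> i)"
    unfolding shift_closed_def
  proof (intro conjI ballI impI)
    fix b c assume b: "b \<in> S" and c: "c \<in> B"
      and *: "(\<forall>h\<in>H. wt c h = wt b h + \<alpha> i h) \<or> (\<forall>h\<in>H. wt c h = wt b h - \<alpha> i h)"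
    from b obtain k :: int where k: "\<forall>h\<in>H. wt b h = \<alpha> j h + of_int k * \<alpha> i h" by (auto simp: S_def)
    from * have "(\<forall>h\<in>H. wt c h = \<alpha> j h + of_int (k + 1) * \<alpha> i h) \<or>
        (\<forall>h\<in>H. wt c h = \<alpha> j h + of_int (k - 1) * \<alpha> i h)"
      using k by (auto simp: algebra_simps)
    then show "c \<in> S" using c unfolding S_def by blast
  qed (auto simp: S_def)
  have val: "Re (wt b t) \<ge> of_int r" if "b \<in> S" for b
  proof -
    from that obtain k :: int where bB: "b \<in> B" and k: "\<forall>h\<in>H. wt b h = \<alpha> j h + of_int k * \<alpha> i h"
      by (auto simp: S_def)
    \<comment> \<open>The coefficients of \<open>wt b\<close> over the simple roots. The coefficient
      at \<open>j\<close> is 1, so the root is positive and \<open>k\<close> cannot be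
      negative.\<close>
    define e where "e l = (if l = j then 1 else if l = i then of_int k else (0::complex))" for l
    have e: "(\<Sum>l\<in>I. e l * \<alpha> l h) = \<alpha> j h + of_int k * \<alpha> i h" for h
    proof -
      have "(\<Sum>l\<in>I. e l * \<alpha> l h) = (\<Sum>l\<in>{i,j}. e l * \<alpha> l h)"
        using fin i j by (intro sum.mono_neutral_right) (auto simp: e_def)
      then show ?thesis using ij by (simp add: e_def)
    qed
    have "\<exists>h\<in>H. wt b h \<noteq> 0"
    proof (rule ccontr)
      assume "\<not> (\<exists>h\<in>H. wt b h \<noteq> 0)"
      then have "e j = 0" using li[of e] k e j by auto
      then show False by (simp add: e_def)
    qed
    then have "is_root H (wt b)" by (rule weight_is_root[OF bB])
    then obtain n :: "'i \<Rightarrow> nat" where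
      n: "(\<forall>h\<in>H. wt b h = (\<Sum>l\<in>I. of_nat (n l) * \<alpha> l h)) \<or>
          (\<forall>h\<in>H. wt b h = - (\<Sum>l\<in>I. of_nat (n l) * \<alpha> l h))"
      using sr unfolding simple_roots_def by blast
    have "k \<ge> 0"
      using n
    proof
      assume "\<forall>h\<in>H. wt b h = (\<Sum>l\<in>I. of_nat (n l) * \<alpha> l h)"
      then have "\<forall>h\<in>H. (\<Sum>l\<in>I. (e l - of_nat (n l)) * \<alpha> l h) = 0"
        using k e by (simp add: left_diff_distrib sum_subtractf)
      then have "e i - of_nat (n i) = 0" using li[of "\<lambda>l. e l - of_nat (n l)"] i by blast
      then have "complex_of_int k = of_int (int (n i))" using ij by (simp add: e_def)
      then show ?thesis by (metis of_int_eq_iff of_nat_0_le_iff)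
    next
      assume "\<forall>h\<in>H. wt b h = - (\<Sum>l\<in>I. of_nat (n l) * \<alpha> l h)"
      then have "\<forall>h\<in>H. (\<Sum>l\<in>I. (e l + of_nat (n l)) * \<alpha> l h) = 0"
        using k e by (simp add: distrib_right sum.distrib)
      then have "e j + of_nat (n j) = 0" using li[of "\<lambda>l. e l + of_nat (n l)"] j by blast
      then have "complex_of_nat (Suc (n j)) = 0" by (simp add: e_def)
      then show ?thesis by (simp only: of_nat_eq_0_iff)
    qed
    then show ?thesis using k tH r ait by simp
  qed
  \<comment> \<open>The real parts sum to zero while each is at least \<open>r\<close>, and
    \<open>S\<close> contains a basis vector of weight \<open>\<alpha> j\<close>.\<close>
  have "(\<Sum>b\<in>S. Re (wt b t)) = 0"
    using sum_weights_coroot[OF t sc] by (metis Re_sum zero_complex.simps(1))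
  moreover have "(\<Sum>b\<in>S. Re (wt b t)) \<ge> (\<Sum>b\<in>S. of_int r)" by (rule sum_mono) (rule val)
  moreover have "card S > 0"
  proof -
    have "is_root H (\<alpha> j)" using sr j by (simp add: simple_roots_def)
    then obtain b where "b \<in> B" "\<forall>h\<in>H. wt b h = \<alpha> j h" using root_has_basis_vector by blast
    then have "b \<in> S" unfolding S_def by (auto intro!: exI[of _ "0::int"])
    then show ?thesis using finite_B by (auto simp: card_gt_0_iff S_def)
  qed
  ultimately have "real (card S) * of_int r \<le> 0" by simp
  then show ?thesis using \<open>card S > 0\<close> by (simp add: mult_le_0_iff)
qed

text \<open>Evaluation at \<open>t\<close> itself exhibits \<open>2 * c\<close> as a sum of squares
  of real weights, to which a basis vector of weight \<alpha> contributes 4.\<close>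

lemma trace_form_coroot_pos:
  assumes rt: "is_root H \<alpha>" and t: "is_coroot H \<alpha> t"
  shows "\<exists>c>0. (\<forall>h\<in>H. trace_form t h = of_real c * \<alpha> h) \<and> (\<Sum>b\<in>B. (Re (wt b t))\<^sup>2) = 2 * c"
proof -
  obtain c where c: "\<And>h. h \<in> H \<Longrightarrow> trace_form t h = c * \<alpha> h" using trace_form_coroot[OF t] by auto
  define q where "q = (\<Sum>b\<in>B. (Re (wt b t))\<^sup>2)"
  have tH: "t \<in> H" and at: "\<alpha> t = 2" using coroot_in_cartan t by (auto simp: is_coroot_def)
  have "c * 2 = (\<Sum>b\<in>B. wt b t * wt b t)" using c[OF tH] at trace_form_cartan[OF tH tH] by simp
  also have "\<dots> = (\<Sum>b\<in>B. of_real ((Re (wt b t))\<^sup>2))"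
    by (rule sum.cong) (use weight_coroot_real[OF t] in \<open>auto simp: power2_eq_square\<close>)
  also have "\<dots> = of_real q" by (simp add: q_def)
  finally have cq: "c = of_real (q / 2)" by simp
  obtain b where b: "b \<in> B" "wt b t = 2" using root_has_basis_vector[OF rt] tH at by auto
  have "(Re (wt b t))\<^sup>2 \<le> q" unfolding q_def using b finite_B by (intro member_le_sum) auto
  then have "q / 2 > 0" unfolding b(2) by simp
  show ?thesis
  proof (intro exI[of _ "q / 2"] conjI ballI)
    show "q / 2 > 0" by fact
    show "trace_form t h = of_real (q / 2) * \<alpha> h" if "h \<in> H" for h
      using c[OF that] by (simp only: cq)
    show "(\<Sum>b\<in>B. (Re (wt b t))\<^sup>2) = 2 * (q / 2)" by (simp add: q_def)
  qed
qed

text \<open>Symmetry of the Killing form gives \<open>c * s = d * r\<close>, which turns the strict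
  Cauchy-Schwarz inequality into \<open>r * s < 4\<close>. Since \<open>r\<close> and
  \<open>s\<close> are nonpositive and vanish together, six pairs remain.\<close>

lemma cartan_integers:
  fixes \<alpha> :: "'i \<Rightarrow> 'g \<Rightarrow> complex"
  assumes sr: "simple_roots H I \<alpha>" and i: "i \<in> I" and j: "j \<in> I" and ij: "i \<noteq> j"
    and t: "is_coroot H (\<alpha> i) t" and r: "\<alpha> j t = of_int r"
    and u: "is_coroot H (\<alpha> j) u" and s: "\<alpha> i u = of_int s"
  shows "(r, s) \<in> {(0,0), (-1,-1), (-1,-2), (-2,-1), (-1,-3), (-3,-1)}"
proof -
  have tH: "t \<in> H" "u \<in> H" using coroot_in_cartan t u by auto
  have rt: "is_root H (\<alpha> i)" "is_root H (\<alpha> j)" using sr i j by (auto simp: simple_roots_def)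
  obtain c where c: "c > 0" "\<And>h. h \<in> H \<Longrightarrow> trace_form t h = of_real c * \<alpha> i h"
    "(\<Sum>b\<in>B. (Re (wt b t))\<^sup>2) = 2 * c" using trace_form_coroot_pos[OF rt(1) t] by blast
  obtain d where d: "d > 0" "\<And>h. h \<in> H \<Longrightarrow> trace_form u h = of_real d * \<alpha> j h"
    "(\<Sum>b\<in>B. (Re (wt b u))\<^sup>2) = 2 * d" using trace_form_coroot_pos[OF rt(2) u] by blast
  have "complex_of_real (c * s) = trace_form t u" using c(2)[OF tH(2)] s by simp
  also have "\<dots> = trace_form u t" using tH by (simp add: trace_form_cartan mult.commute)
  also have "\<dots> = of_real (d * r)" using d(2)[OF tH(1)] r by simp
  finally have cd: "c * s = d * r" by (simp only: of_real_eq_iff)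
  have "(\<Sum>b\<in>B. Re (wt b t) * Re (wt b u)) = Re (\<Sum>b\<in>B. wt b t * wt b u)"
    unfolding Re_sum using weight_coroot_real[OF t]
    by (intro sum.cong) (auto simp: complex_is_Real_iff)
  also have "\<dots> = Re (trace_form t u)" using tH by (simp add: trace_form_cartan)
  also have "\<dots> = c * s" using c(2)[OF tH(2)] s by simp
  finally have cs: "(\<Sum>b\<in>B. Re (wt b t) * Re (wt b u)) = c * s" .
  have r0: "r \<le> 0" by (rule simple_root_coroot_nonpos[OF sr i j ij t r])
  have s0: "s \<le> 0" by (rule simple_root_coroot_nonpos[OF sr j i ij[symmetric] u s])
  have "r * s < 4"
  proof (rule ccontr)
    assume "\<not> r * s < 4"
    then have rs: "real_of_int r * real_of_int s \<ge> 4"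
      by (metis not_less of_int_le_iff of_int_mult of_int_numeral)
    \<comment> \<open>The weights of a multiple of \<open>t\<close> minus its projection to
      \<open>u\<close>: the squared length of \<open>u\<close> is \<open>2 * d\<close> and the inner
      product is \<open>c * s\<close>. With \<open>r * s\<close> at least 4 the squared length of
      this vector is at most 0.\<close>
    let ?f = "\<lambda>b. 2 * d * Re (wt b t) - c * s * Re (wt b u)"
    have "(\<Sum>b\<in>B. (?f b)\<^sup>2) = (\<Sum>b\<in>B. (2 * d)\<^sup>2 * (Re (wt b t))\<^sup>2
        + (c * s)\<^sup>2 * (Re (wt b u))\<^sup>2 - 2 * (2 * d) * (c * s) * (Re (wt b t) * Re (wt b u)))"
      by (rule sum.cong) (auto simp: power2_eq_square algebra_simps)
    also have "\<dots> = (2 * d)\<^sup>2 * (2 * c) + (c * s)\<^sup>2 * (2 * d) - 2 * (2 * d) * (c * s) * (c * s)"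
      by (simp only: sum.distrib sum_subtractf sum_distrib_left[symmetric] c(3) d(3) cs)
    also have "\<dots> = 2 * d * (4 * c * d - (c * s) * (c * s))"
      by (simp add: power2_eq_square algebra_simps)
    also have "(c * s) * (c * s) = c * d * (real_of_int r * real_of_int s)"
      by (subst (2) cd) (simp add: algebra_simps)
    also have "2 * d * (4 * c * d - c * d * (real_of_int r * real_of_int s)) \<le> 0"
      using rs c(1) d(1) by (simp add: mult_le_0_iff)
    finally have "(\<Sum>b\<in>B. (?f b)\<^sup>2) = 0" by (simp add: antisym sum_nonneg)
    then have f0: "?f b = 0" if "b \<in> B" for b
      using sum_nonneg_eq_0_iff[OF finite_B, of "\<lambda>b. (?f b)\<^sup>2"] that by simp
    have wt0: "of_real (2 * d) * wt b t = of_real (c * s) * wt b u" if "b \<in> B" for b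
      using f0[OF that] weight_coroot_real[OF t that] weight_coroot_real[OF u that]
      by (simp add: complex_eq_iff complex_is_Real_iff)
    \<comment> \<open>Equal weights give equal Killing forms with \<open>H\<close>, and these are
      multiples of \<open>\<alpha> i\<close> and \<open>\<alpha> j\<close>. The result contradicts
      the independence of the simple roots.\<close>
    have tu: "of_real (2 * d) * trace_form t h = of_real (c * s) * trace_form u h" if "h \<in> H" for h
    proof -
      have "of_real (2 * d) * trace_form t h = (\<Sum>b\<in>B. (of_real (2 * d) * wt b t) * wt b h)"
        by (simp add: trace_form_cartan tH that sum_distrib_left mult.assoc)
      also have "\<dots> = (\<Sum>b\<in>B. (of_real (c * s) * wt b u) * wt b h)"
        by (rule sum.cong) (simp_all only: wt0)
      also have "\<dots> = of_real (c * s) * trace_form u h"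
        by (simp add: trace_form_cartan tH that sum_distrib_left mult.assoc)
      finally show ?thesis .
    qed
    have *: "of_real (2 * d * c) * \<alpha> i h - of_real (c * s * d) * \<alpha> j h = 0" if "h \<in> H" for h
      using tu[OF that] unfolding c(2)[OF that] d(2)[OF that] of_real_mult mult.assoc by simp
    define e where "e l = (if l = i then of_real (2 * d * c) else if l = j then - of_real (c * s * d) else (0::complex))" for l
    have "(\<Sum>l\<in>I. e l * \<alpha> l h) = 0" if "h \<in> H" for h
    proof -
      have "(\<Sum>l\<in>I. e l * \<alpha> l h) = (\<Sum>l\<in>{i,j}. e l * \<alpha> l h)"
        using sr i j by (intro sum.mono_neutral_right) (auto simp: e_def simple_roots_def)
      then show ?thesis using ij *[OF that] by (simp add: e_def)
    qed
    then have "e i = 0" using sr i unfolding simple_roots_def by blast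
    then show False using c(1) d(1) by (simp add: e_def)
  qed
  moreover have "r = 0 \<longleftrightarrow> s = 0"
    using cd c(1) d(1) by auto
  ultimately show ?thesis
  proof (cases "r = 0")
    case False
    define m n where "m = - r" and "n = - s"
    have mn: "m \<ge> 1" "n \<ge> 1" "m * n < 4"
      using False \<open>r = 0 \<longleftrightarrow> s = 0\<close> r0 s0 \<open>r * s < 4\<close> by (auto simp: m_def n_def)
    have "m * 1 \<le> m * n" "1 * n \<le> m * n" using mn by (auto intro: mult_mono)
    then have "m \<le> 3" "n \<le> 3" using mn(3) by linarith+
    then have "m \<in> {1, 2, 3}" "n \<in> {1, 2, 3}" using mn(1,2) by auto
    then have "(m, n) \<in> {(1,1), (1,2), (2,1), (1,3), (3,1)}" using mn(3) by auto
    then show ?thesis by (auto simp: m_def n_def)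
  qed auto
qed

end

section \<open>Diagonal and off-diagonal entries of a Cartan matrix\<close>

context complex_lie_algebra
begin

lemma cartan_matrix_entries:
  assumes "is_cartan_matrix I a"
  shows "finite I" and "i \<in> I \<Longrightarrow> a i i = 2"
    and "i \<in> I \<Longrightarrow> j \<in> I \<Longrightarrow> i \<noteq> j \<Longrightarrow>
      (a i j, a j i) \<in> {(0,0), (-1,-1), (-1,-2), (-2,-1), (-1,-3), (-3,-1)}"
proof -
  obtain H \<alpha> \<alpha>v where *: "cartan_subalgebra H" "simple_roots H I \<alpha>"
    "\<And>i. i \<in> I \<Longrightarrow> is_coroot H (\<alpha> i) (\<alpha>v i)"
    "\<And>i j. i \<in> I \<Longrightarrow> j \<in> I \<Longrightarrow> \<alpha> j (\<alpha>v i) = of_int (a i j)"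
    using assms unfolding is_cartan_matrix_def by blast
  obtain B wt where "cartan_eigenbasis scale br H B wt"
    using cartan_eigenbasis_exists[OF *(1)] by auto
  then interpret cartan_eigenbasis scale br H B wt .
  show "finite I" using *(2) by (simp add: simple_roots_def)
  show "a i i = 2" if "i \<in> I"
  proof -
    have "complex_of_int (a i i) = of_int 2" using *(3)[OF that] *(4)[OF that that] by (simp add: is_coroot_def)
    then show ?thesis by (simp only: of_int_eq_iff)
  qed
  show "(a i j, a j i) \<in> {(0,0), (-1,-1), (-1,-2), (-2,-1), (-1,-3), (-3,-1)}"
    if "i \<in> I" "j \<in> I" "i \<noteq> j"
    using cartan_integers[OF *(2) that *(3)[OF that(1)] *(4)[OF that(1,2)] *(3)[OF that(2)] *(4)[OF that(2,1)]] .
qed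

end


section \<open>The action separating the elements of the kernel\<close>

text \<open>If \<open>X j\<close> is the image of simple root \<open>j\<close> under w, the result
  is minus its image under w times the reflection at \<open>i\<close>. The sign makes
  \<open>X i\<close> fixed when \<open>b i i = 2\<close>; transposing \<open>b\<close> gives the
  version for coroots.\<close>

definition refl_step :: "('i \<Rightarrow> 'i \<Rightarrow> int) \<Rightarrow> 'i \<Rightarrow> ('i \<Rightarrow> 'i \<Rightarrow> int) \<Rightarrow> 'i \<Rightarrow> 'i \<Rightarrow> int" where
  "refl_step b i X j = (\<lambda>k. b i j * X i k - X j k)"

text \<open>The choice of \<open>y\<close> depends only on the set \<open>{x, -x}\<close>, so exactly one of two opposite nonzero
  vectors is negative.\<close>

definition neg_vec :: "('i \<Rightarrow> int) \<Rightarrow> bool" where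
  "neg_vec x \<longleftrightarrow> (SOME y. y = x \<or> y = (\<lambda>k. - x k)) \<noteq> x"

lemma neg_vec_uminus:
  assumes "x \<noteq> (\<lambda>_. 0)"
  shows "neg_vec (\<lambda>k. - x k) \<longleftrightarrow> \<not> neg_vec x"
proof -
  define y where "y = (SOME y. y = x \<or> y = (\<lambda>k. - x k))"
  have y: "y = x \<or> y = (\<lambda>k. - x k)"
    unfolding y_def by (rule someI[where x = x]) simp
  have "(SOME y. y = (\<lambda>k. - x k) \<or> y = (\<lambda>k. - (- x k))) = y"
    unfolding y_def by (rule arg_cong[where f = Eps]) auto
  moreover have "x \<noteq> (\<lambda>k. - x k)"
  proof
    assume *: "x = (\<lambda>k. - x k)"
    have "x k = 0" for k using fun_cong[OF *, of k] by simp
    with assms show False by auto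
  qed
  ultimately show ?thesis
    using y unfolding neg_vec_def y_def[symmetric] by auto
qed

text \<open>A state \<open>(A, C, v)\<close> records, for an element \<open>w\<close> of the Weyl group, the vectors \<open>A j = \<plusminus> w \<alpha>\<^sub>j\<close>
  and \<open>C j = \<plusminus> w \<alpha>\<^sub>j\<^sup>\<or>\<close> (sign \<open>(-1)\<close> to the length of the word) in coordinates, and an element \<open>v\<close> of
  the coroot lattice modulo 2. The flag \<open>e\<close> of \<open>uact\<close> distinguishes \<open>SigBar i\<close> from \<open>Sig i\<close>.\<close>

type_synonym 'i ustate = "('i \<Rightarrow> 'i \<Rightarrow> int) \<times> ('i \<Rightarrow> 'i \<Rightarrow> int) \<times> ('i \<Rightarrow> bool)"

definition uact :: "('i \<Rightarrow> 'i \<Rightarrow> int) \<Rightarrow> bool \<Rightarrow> 'i \<Rightarrow> 'i ustate \<Rightarrow> 'i ustate" where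
  "uact a e i = (\<lambda>(A, C, v). (refl_step a i A, refl_step (\<lambda>p q. a q p) i C,
     \<lambda>k. v k \<noteq> ((neg_vec (A i) \<noteq> e) \<and> odd (C i k))))"

text \<open>Integer coordinates in the plane of two stored vectors, which turn the braid relation
  into arithmetic with numerals.\<close>

definition comb :: "('i \<Rightarrow> int) \<Rightarrow> ('i \<Rightarrow> int) \<Rightarrow> int \<Rightarrow> int \<Rightarrow> 'i \<Rightarrow> int" where
  "comb x y p q = (\<lambda>k. p * x k + q * y k)"

definition step_vec :: "int \<Rightarrow> ('i \<Rightarrow> int) \<Rightarrow> ('i \<Rightarrow> int) \<Rightarrow> 'i \<Rightarrow> int" where
  "step_vec c x y = (\<lambda>k. c * x k - y k)"

lemma step_vec_comb: "step_vec c (comb x y p q) (comb x y p' q') = comb x y (c * p - p') (c * q - q')"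
  by (auto simp: step_vec_def comb_def algebra_simps)

lemma refl_step_self: "b i i = 2 \<Longrightarrow> refl_step b i X i = X i"
  by (auto simp: refl_step_def)

lemma refl_step_other: "refl_step b i X j = step_vec (b i j) (X i) (X j)"
  by (auto simp: refl_step_def step_vec_def)

lemma refl_step_invol: "b i i = 2 \<Longrightarrow> refl_step b i (refl_step b i X) = X"
  by (auto simp: refl_step_def fun_eq_iff)

text \<open>An invariant of the states that are reached: it keeps the combinations tested in the
  braid relation nonzero, as \<open>neg_vec_uminus\<close> demands.\<close>

definition indep_family :: "'i set \<Rightarrow> ('i \<Rightarrow> 'i \<Rightarrow> int) \<Rightarrow> bool" where
  "indep_family I A \<longleftrightarrow> (\<forall>n. (\<forall>k. (\<Sum>j\<in>I. n j * A j k) = 0) \<longrightarrow> (\<forall>j\<in>I. n j = 0))"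

lemma indep_family_refl_step:
  assumes fin: "finite I" and A: "indep_family I A" and i: "i \<in> I" and aii: "a i i = 2"
  shows "indep_family I (refl_step a i A)"
  unfolding indep_family_def
proof (intro allI impI)
  fix n
  assume n: "\<forall>k. (\<Sum>j\<in>I. n j * refl_step a i A j k) = 0"
  \<comment> \<open>The coefficients of the same relation after the reflected vectors are expanded
    in terms of \<open>A\<close>.\<close>
  define n' where "n' j = (if j = i then (\<Sum>l\<in>I. n l * a i l) - n i else - n j)" for j
  have "(\<Sum>j\<in>I. n' j * A j k) = 0" for k
  proof -
    have "(\<Sum>j\<in>I. n' j * A j k) = n' i * A i k + (\<Sum>j\<in>I - {i}. n' j * A j k)"
      using fin i by (rule sum.remove)
    also have "(\<Sum>j\<in>I - {i}. n' j * A j k) = (\<Sum>j\<in>I - {i}. - n j * A j k)"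
      by (rule sum.cong) (auto simp: n'_def)
    also have "n' i * A i k + \<dots> = (\<Sum>l\<in>I. n l * a i l) * A i k + (\<Sum>j\<in>I. - n j * A j k)"
      using fin i by (subst (2) sum.remove[of I i]) (auto simp: n'_def algebra_simps)
    also have "\<dots> = (\<Sum>j\<in>I. n j * refl_step a i A j k)"
      by (simp add: refl_step_def sum_distrib_left algebra_simps sum_subtractf sum_negf)
    finally show ?thesis using n by simp
  qed
  then have n'0: "\<forall>j\<in>I. n' j = 0" using A by (auto simp: indep_family_def)
  then have *: "n j = 0" if "j \<in> I" "j \<noteq> i" for j
    using that by (force simp: n'_def)
  have "(\<Sum>l\<in>I. n l * a i l) = n i * a i i"
    using fin i by (subst sum.remove[of I i]) (auto simp: *)
  then have "n i = 0" using n'0 i aii by (force simp: n'_def)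
  then show "\<forall>j\<in>I. n j = 0" using * by blast
qed

lemma indep_family_comb:
  assumes fin: "finite I" and A: "indep_family I A" and "i \<in> I" "j \<in> I" "i \<noteq> j"
    and pq: "p \<noteq> 0 \<or> q \<noteq> 0"
  shows "comb (A i) (A j) p q \<noteq> (\<lambda>_. 0)"
proof
  assume *: "comb (A i) (A j) p q = (\<lambda>_. 0)"
  define n where "n l = (if l = i then p else if l = j then q else 0)" for l
  have "(\<Sum>l\<in>I. n l * A l k) = 0" for k
  proof -
    have "(\<Sum>l\<in>I. n l * A l k) = (\<Sum>l\<in>{i,j}. n l * A l k)"
      using assms by (intro sum.mono_neutral_right) (auto simp: n_def)
    also have "\<dots> = comb (A i) (A j) p q k"
      using \<open>i \<noteq> j\<close> by (simp add: comb_def n_def)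
    finally show ?thesis using * by simp
  qed
  then have "n i = 0" "n j = 0" using A assms by (auto simp: indep_family_def)
  with pq \<open>i \<noteq> j\<close> show False by (auto simp: n_def)
qed

text \<open>Both words have the same length, so the sign reversals agree and this is the braid
  relation of the simple reflections, expanded for each of the six pairs.\<close>

lemma refl_step_braid:
  assumes "b i i = 2" "b j j = 2"
    and c: "(b i j, b j i) \<in> {(0,0), (-1,-1), (-1,-2), (-2,-1), (-1,-3), (-3,-1)}"
  shows "fold (refl_step b) (alternating (braid_length b i j) i j) X =
         fold (refl_step b) (alternating (braid_length b i j) j i) X"
  using assms
  by (auto simp: braid_length_def numeral_eq_Suc refl_step_def fun_eq_iff algebra_simps)

lemma fold_uact_fst: "fst (fold (\<lambda>i. uact a e i) w s) = fold (refl_step a) w (fst s)"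
  by (induction w arbitrary: s) (auto simp: uact_def split: prod.splits)

lemma fold_uact_fst_snd: "fst (snd (fold (\<lambda>i. uact a e i) w s)) = fold (refl_step (\<lambda>p q. a q p)) w (fst (snd s))"
  by (induction w arbitrary: s) (auto simp: uact_def split: prod.splits)

lemma uact_Pair:
  "uact a e i (A, C, v) = (refl_step a i A, refl_step (\<lambda>p q. a q p) i C,
     \<lambda>k. v k \<noteq> ((neg_vec (A i) \<noteq> e) \<and> odd (C i k)))"
  by (simp add: uact_def)

lemma odd_comb: "odd (comb x y p q k) \<longleftrightarrow> (odd p \<and> odd (x k)) \<noteq> (odd q \<and> odd (y k))"
  by (auto simp: comb_def)

text \<open>Both sides of the braid relation run through the same positive roots of the rank two system, in
  opposite orders. For even braid length the signs of the stored vectors are opposite, which the bars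
  compensate by \<open>neg_vec_uminus\<close>; for braid length 3 the three coroots add up to 0 modulo 2.\<close>

lemma uact_braid_snd_snd:
  assumes fin: "finite I" and A: "indep_family I A" and ij: "i \<in> I" "j \<in> I" "i \<noteq> j"
    and a: "a i i = 2" "a j j = 2"
    and c: "(a i j, a j i) \<in> {(0,0), (-1,-1), (-1,-2), (-2,-1), (-1,-3), (-3,-1)}"
  shows "snd (snd (fold (\<lambda>i. uact a False i) (alternating (braid_length a i j) i j) (A, C, v))) =
         snd (snd (fold (\<lambda>i. uact a True i) (alternating (braid_length a i j) j i) (A, C, v)))"
proof -
  define x y z w where "x = A i" and "y = A j" and "z = C i" and "w = C j"
  have 0: "A i = comb x y 1 0" "A j = comb x y 0 1" "C i = comb z w 1 0" "C j = comb z w 0 1"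
    by (auto simp: x_def y_def z_def w_def comb_def)
  have H: "neg_vec (comb x y (- p) (- q)) \<longleftrightarrow> \<not> neg_vec (comb x y p q)" if "p \<noteq> 0 \<or> q \<noteq> 0" for p q
  proof -
    have "comb x y (- p) (- q) = (\<lambda>k. - comb x y p q k)" by (auto simp: comb_def)
    then show ?thesis
      using neg_vec_uminus indep_family_comb[OF fin A ij that] by (simp add: x_def y_def)
  qed
  \<comment> \<open>The coordinates are those of the positive roots of all rank two systems, in both
    orders of the simple roots.\<close>
  note H' = H[of 1 0, simplified] H[of 0 1, simplified] H[of 1 1, simplified] H[of 1 2, simplified]
    H[of 2 1, simplified] H[of 1 3, simplified] H[of 3 1, simplified] H[of 3 2, simplified] H[of 2 3, simplified]
  note S = uact_Pair refl_step_self refl_step_other step_vec_comb 0 braid_length_def odd_comb H'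
  from c consider "a i j = 0 \<and> a j i = 0" | "a i j = -1 \<and> a j i = -1" | "a i j = -1 \<and> a j i = -2"
    | "a i j = -2 \<and> a j i = -1" | "a i j = -1 \<and> a j i = -3" | "a i j = -3 \<and> a j i = -1" by auto
  then show ?thesis
  proof cases
    case 1
    then show ?thesis using a by (auto simp: S numeral_2_eq_2 fun_eq_iff)
  next
    case 2
    then show ?thesis using a by (auto simp: S numeral_3_eq_3 fun_eq_iff)
  next
    case 3
    then show ?thesis using a by (auto simp: S eval_nat_numeral fun_eq_iff)
  next
    case 4
    then show ?thesis using a by (auto simp: S eval_nat_numeral fun_eq_iff)
  next
    case 5
    then show ?thesis using a by (auto simp: S eval_nat_numeral fun_eq_iff)
  next
    case 6
    then show ?thesis using a by (auto simp: S eval_nat_numeral fun_eq_iff)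
  qed
qed

text \<open>Both sides test the same vectors with \<open>neg_vec\<close>. If \<open>C'\<close>
  denotes the coroot vectors after the first step, the bars add \<open>C j\<close>, then
  \<open>C' i\<close> when \<open>a j i\<close> is odd, then \<open>a j i * C' i - C j\<close>;
  these cancel modulo 2.\<close>

lemma uact_conj:
  assumes "a i i = 2" "a j j = 2"
  shows "uact a False j (uact a False i (uact a False j s)) =
    uact a True j (uact a (odd (a j i)) i (uact a True j s))"
proof -
  obtain A C v where "s = (A, C, v)" by (cases s) auto
  then show ?thesis
    using assms by (auto simp: uact_Pair refl_step_def fun_eq_iff)
qed

text \<open>The first step fixes \<open>A i\<close> and \<open>C i\<close>, so both steps test the
  same vector. Equal flags show that generators act as involutions; unequal flags give the
  translation by which \<open>\<eta>\<^sub>i\<close> acts.\<close>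

lemma uact_uact: "a i i = 2 \<Longrightarrow> uact a e i (uact a f i (A, C, v)) = (A, C, \<lambda>k. v k \<noteq> (e \<noteq> f \<and> odd (C i k)))"
  by (auto simp: uact_Pair refl_step_invol refl_step_self)

lemma uact_braid:
  assumes "finite I" "indep_family I A" "i \<in> I" "j \<in> I" "i \<noteq> j"
    and a: "a i i = 2" "a j j = 2"
    and c: "(a i j, a j i) \<in> {(0,0), (-1,-1), (-1,-2), (-2,-1), (-1,-3), (-3,-1)}"
  shows "fold (uact a False) (alternating (braid_length a i j) i j) (A, C, v) =
         fold (uact a True) (alternating (braid_length a i j) j i) (A, C, v)"
proof (intro prod_eqI)
  have "braid_length (\<lambda>p q. a q p) i j = braid_length a i j"
    by (simp add: braid_length_def mult.commute)
  moreover have "(a j i, a i j) \<in> {(0,0), (-1,-1), (-1,-2), (-2,-1), (-1,-3), (-3,-1)}"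
    using c by auto
  ultimately show "fst (snd (fold (uact a False) (alternating (braid_length a i j) i j) (A, C, v))) =
         fst (snd (fold (uact a True) (alternating (braid_length a i j) j i) (A, C, v)))"
    using refl_step_braid[of "\<lambda>p q. a q p" i j C] a by (simp add: fold_uact_fst_snd)
qed (use refl_step_braid[of a i j A] uact_braid_snd_snd[of I A i j a C v] assms in
    \<open>simp_all add: fold_uact_fst\<close>)


section \<open>Presented groups and the extension\<close>

definition word_class :: "'a set \<Rightarrow> (('a \<times> bool) list \<times> ('a \<times> bool) list) set \<Rightarrow>
    ('a \<times> bool) list \<Rightarrow> ('a \<times> bool) list set" where
  "word_class S R u = {w. word_eq S R u w}"

definition inverse_word :: "('a \<times> bool) list \<Rightarrow> ('a \<times> bool) list" where
  "inverse_word w = map (\<lambda>(s, b). (s, \<not> b)) (rev w)"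

definition map_word :: "('a \<Rightarrow> 'b) \<Rightarrow> ('a \<times> bool) list \<Rightarrow> ('b \<times> bool) list" where
  "map_word \<phi> = map (map_prod \<phi> id)"

lemma word_eq_group_words: "word_eq S R u v \<Longrightarrow> u \<in> group_words S \<and> v \<in> group_words S"
  by (induction rule: word_eq.induct) (auto simp: group_words_def)

lemma group_words_simps [simp]:
  "[] \<in> group_words S"
  "x # u \<in> group_words S \<longleftrightarrow> fst x \<in> S \<and> u \<in> group_words S"
  "u @ v \<in> group_words S \<longleftrightarrow> u \<in> group_words S \<and> v \<in> group_words S"
  by (cases x; auto simp: group_words_def)+

lemma map_word_simps [simp]:
  "map_word \<phi> [] = []"
  "map_word \<phi> (x # u) = (\<phi> (fst x), snd x) # map_word \<phi> u"
  "map_word \<phi> (u @ v) = map_word \<phi> u @ map_word \<phi> v"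
  by (cases x; auto simp: map_word_def)+

lemma map_word_map_word: "map_word \<phi> (map_word \<psi> u) = map_word (\<lambda>x. \<phi> (\<psi> x)) u"
  by (induction u) auto

lemma map_word_in_group_words:
  "u \<in> group_words S \<Longrightarrow> \<phi> ` S \<subseteq> S' \<Longrightarrow> map_word \<phi> u \<in> group_words S'"
  by (induction u) auto

lemma pos_word_simps [simp]:
  "pos_word [] = []"
  "pos_word (x # xs) = (x, True) # pos_word xs"
  by (auto simp: pos_word_def)

lemma map_word_pos_word: "map_word \<phi> (pos_word xs) = pos_word (map \<phi> xs)"
  by (induction xs) auto

lemma pos_word_in_group_words: "pos_word xs \<in> group_words S \<longleftrightarrow> set xs \<subseteq> S"
  by (induction xs) auto

lemma inverse_word_simps [simp]:
  "inverse_word [] = []"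
  "inverse_word (x # u) = inverse_word u @ [(fst x, \<not> snd x)]"
  by (cases x; auto simp: inverse_word_def)+

lemma inverse_word_in_group_words: "u \<in> group_words S \<Longrightarrow> inverse_word u \<in> group_words S"
  by (induction u) auto

lemma inverse_word_append: "inverse_word (u @ v) = inverse_word v @ inverse_word u"
  by (induction u) auto

lemma inverse_word_inverse_word: "inverse_word (inverse_word u) = u"
  by (induction u) (auto simp: inverse_word_append)

lemma word_eq_append_inverse_word: "u \<in> group_words S \<Longrightarrow> word_eq S R (u @ inverse_word u) []"
proof (induction u)
  case (Cons x u)
  obtain s b where x: "x = (s, b)" by (cases x)
  have s: "s \<in> S" and u: "u \<in> group_words S" using Cons.prems x by auto
  have "word_eq S R [(s, b)] [(s, b)]" using s by (simp add: word_eq.refl)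
  moreover have "word_eq S R ((u @ inverse_word u) @ [(s, \<not> b)]) ([] @ [(s, \<not> b)])"
    using Cons.IH[OF u] s by (intro word_eq.append word_eq.refl) auto
  ultimately have "word_eq S R ([(s, b)] @ (u @ inverse_word u) @ [(s, \<not> b)]) ([(s, b)] @ [] @ [(s, \<not> b)])"
    unfolding append_assoc by (rule word_eq.append)
  then have "word_eq S R ((x # u) @ inverse_word (x # u)) [(s, b), (s, \<not> b)]"
    by (simp add: x)
  then show ?case using word_eq.cancel[OF s, of R b] by (rule word_eq.trans)
qed (simp add: word_eq.refl)

lemma word_class_eq_iff:
  assumes "u \<in> group_words S"
  shows "word_class S R u = word_class S R v \<longleftrightarrow> word_eq S R u v"
proof
  assume "word_class S R u = word_class S R v"
  moreover have "u \<in> word_class S R u" using assms by (simp add: word_class_def word_eq.refl)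
  ultimately show "word_eq S R u v" by (auto simp: word_class_def intro: word_eq.sym)
next
  assume "word_eq S R u v"
  then show "word_class S R u = word_class S R v"
    unfolding word_class_def by (blast intro: word_eq.sym word_eq.trans)
qed

lemma carrier_presented_group:
  "carrier (presented_group S R) = word_class S R ` group_words S"
  by (auto simp: presented_group_def quotient_def word_class_def)

lemma one_presented_group: "\<one>\<^bsub>presented_group S R\<^esub> = word_class S R []"
  by (simp add: presented_group_def word_class_def)

lemma mult_presented_group:
  assumes "u \<in> group_words S" "v \<in> group_words S"
  shows "word_class S R u \<otimes>\<^bsub>presented_group S R\<^esub> word_class S R v = word_class S R (u @ v)"
proof -
  have "word_eq S R (u @ v) w" if "word_eq S R u u'" "word_eq S R v v'" "word_eq S R (u' @ v') w" for u' v' w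
    using word_eq.trans[OF word_eq.append[OF that(1,2)] that(3)] .
  moreover have "word_eq S R u u" "word_eq S R v v" using assms by (auto intro: word_eq.refl)
  ultimately show ?thesis
    unfolding presented_group_def word_class_def by auto
qed

lemma word_class_in_carrier:
  "u \<in> group_words S \<Longrightarrow> word_class S R u \<in> carrier (presented_group S R)"
  by (simp add: carrier_presented_group)

lemma group_presented_group: "group (presented_group S R)"
proof (rule groupI)
  fix x assume "x \<in> carrier (presented_group S R)"
  then obtain u where u: "u \<in> group_words S" "x = word_class S R u"
    by (auto simp: carrier_presented_group)
  have "word_eq S R (inverse_word u @ u) []"
    using word_eq_append_inverse_word[OF inverse_word_in_group_words[OF u(1)]]
    by (simp add: inverse_word_inverse_word)
  then have "word_class S R (inverse_word u) \<otimes>\<^bsub>presented_group S R\<^esub> x = \<one>\<^bsub>presented_group S R\<^esub>"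
    using u inverse_word_in_group_words[OF u(1)]
    by (simp add: mult_presented_group one_presented_group word_class_eq_iff)
  then show "\<exists>y\<in>carrier (presented_group S R). y \<otimes>\<^bsub>presented_group S R\<^esub> x = \<one>\<^bsub>presented_group S R\<^esub>"
    using word_class_in_carrier[OF inverse_word_in_group_words[OF u(1)]] by blast
qed (auto simp: carrier_presented_group one_presented_group mult_presented_group)

lemma word_eq_map_word:
  assumes "word_eq S R u v" and \<phi>: "\<phi> ` S \<subseteq> S'"
    and R: "\<And>u v. (u, v) \<in> R \<Longrightarrow> u \<in> group_words S \<Longrightarrow> v \<in> group_words S \<Longrightarrow>
      word_eq S' R' (map_word \<phi> u) (map_word \<phi> v)"
  shows "word_eq S' R' (map_word \<phi> u) (map_word \<phi> v)"
  using assms(1)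
proof (induction rule: word_eq.induct)
  case (refl u)
  then show ?case using map_word_in_group_words[OF _ \<phi>] by (intro word_eq.refl)
next
  case (sym u v)
  then show ?case by (blast intro: word_eq.sym)
next
  case (trans u v w)
  then show ?case by (blast intro: word_eq.trans)
next
  case (append u v u' v')
  then show ?case by (simp add: word_eq.append)
next
  case (cancel s b)
  then show ?case using \<phi> by (auto intro: word_eq.cancel)
qed (rule R)

text \<open>The universal property for maps that send generators to generators, the form in which
  the projection to the Weyl group arises.\<close>

lemma presented_group_hom_exists:
  assumes \<phi>: "\<phi> ` S \<subseteq> S'"
    and R: "\<And>u v. (u, v) \<in> R \<Longrightarrow> u \<in> group_words S \<Longrightarrow> v \<in> group_words S \<Longrightarrow>
      word_eq S' R' (map_word \<phi> u) (map_word \<phi> v)"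
  shows "\<exists>h \<in> hom (presented_group S R) (presented_group S' R').
           \<forall>u\<in>group_words S. h (word_class S R u) = word_class S' R' (map_word \<phi> u)"
proof -
  define h where "h X = word_class S' R' (map_word \<phi> (SOME u. u \<in> group_words S \<and> X = word_class S R u))" for X
  have h: "h (word_class S R u) = word_class S' R' (map_word \<phi> u)" if u: "u \<in> group_words S" for u
  proof -
    define v where "v = (SOME v. v \<in> group_words S \<and> word_class S R u = word_class S R v)"
    have v: "v \<in> group_words S \<and> word_class S R u = word_class S R v"
      unfolding v_def by (rule someI[of _ u]) (simp add: u)
    then have "word_eq S R u v" using word_class_eq_iff[OF u] by blast
    then have "word_eq S' R' (map_word \<phi> u) (map_word \<phi> v)" by (rule word_eq_map_word[OF _ \<phi> R])
    then have "word_class S' R' (map_word \<phi> u) = word_class S' R' (map_word \<phi> v)"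
      using word_class_eq_iff[OF map_word_in_group_words[OF u \<phi>]] by blast
    then show ?thesis by (simp add: h_def v_def)
  qed
  moreover have "h \<in> hom (presented_group S R) (presented_group S' R')"
    by (rule homI) (auto simp: carrier_presented_group h mult_presented_group map_word_in_group_words[OF _ \<phi>])
  ultimately show ?thesis by blast
qed

lemma word_eq_pos_relations:
  "(u, v) \<in> R \<Longrightarrow> set u \<subseteq> S \<Longrightarrow> set v \<subseteq> S \<Longrightarrow>
    word_eq S (pos_relations R) (pos_word u) (pos_word v)"
  by (rule word_eq.rel) (auto simp: pos_relations_def pos_word_in_group_words)

lemma map_alternating: "map f (alternating m x y) = alternating m (f x) (f y)"
  by (induction m arbitrary: x y) auto

lemma set_alternating: "set (alternating m x y) \<subseteq> {x, y}"
  by (induction m arbitrary: x y) auto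

fun ugen_index :: "'i ugen \<Rightarrow> 'i" where
  "ugen_index (Sig i) = i"
| "ugen_index (SigBar i) = i"

lemma swap_bar_funpow: "(swap_bar ^^ n) x = (if even n then x else swap_bar x)"
  by (induction n; cases x) auto

text \<open>\<open>conj_rel\<close> has the power of the bar swap already evaluated by parity.
  \<open>comm_rel\<close> is the braid relation of length 2, since in finite type two even entries
  are both 0.\<close>

locale unitary_generators = group G for G (structure) +
  fixes I :: "'i set" and a :: "'i \<Rightarrow> 'i \<Rightarrow> int" and s sb :: "'i \<Rightarrow> 'a"
  assumes s_closed: "i \<in> I \<Longrightarrow> s i \<in> carrier G" and sb_closed: "i \<in> I \<Longrightarrow> sb i \<in> carrier G"
    and s_sq: "i \<in> I \<Longrightarrow> s i \<otimes> s i = \<one>" and sb_sq: "i \<in> I \<Longrightarrow> sb i \<otimes> sb i = \<one>"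
    and s_sb: "i \<in> I \<Longrightarrow> s i \<otimes> sb i = sb i \<otimes> s i"
    and conj_rel: "i \<in> I \<Longrightarrow> j \<in> I \<Longrightarrow> i \<noteq> j \<Longrightarrow>
      s j \<otimes> s i \<otimes> s j = sb j \<otimes> (if odd (a j i) then sb i else s i) \<otimes> sb j"
    and comm_rel: "i \<in> I \<Longrightarrow> j \<in> I \<Longrightarrow> i \<noteq> j \<Longrightarrow> even (a i j) \<Longrightarrow> even (a j i) \<Longrightarrow>
      s i \<otimes> s j = sb j \<otimes> sb i"
begin

section \<open>The elements \<open>eta i\<close> and the subgroup that they generate\<close>

definition eta :: "'i \<Rightarrow> 'a" where "eta i = s i \<otimes> sb i"

lemma eta_closed: "i \<in> I \<Longrightarrow> eta i \<in> carrier G"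
  by (simp add: eta_def s_closed sb_closed)

lemma sb_eq: "i \<in> I \<Longrightarrow> sb i = s i \<otimes> eta i"
  by (simp add: eta_def s_closed sb_closed m_assoc[symmetric] s_sq)

lemma eta_sq: assumes i: "i \<in> I" shows "eta i \<otimes> eta i = \<one>"
proof -
  have "eta i \<otimes> eta i = s i \<otimes> (sb i \<otimes> s i) \<otimes> sb i"
    using s_closed[OF i] sb_closed[OF i] by (simp add: eta_def m_assoc)
  also have "\<dots> = (s i \<otimes> s i) \<otimes> (sb i \<otimes> sb i)"
    using s_closed[OF i] sb_closed[OF i] by (simp add: s_sb[OF i, symmetric] m_assoc)
  finally show ?thesis by (simp add: s_sq[OF i] sb_sq[OF i])
qed

lemma s_eta_same: assumes i: "i \<in> I" shows "s i \<otimes> eta i = eta i \<otimes> s i"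
  using s_closed[OF i] sb_closed[OF i] by (simp add: eta_def m_assoc s_sb[OF i, symmetric])

text \<open>The conjugation relation multiplied by \<open>sb j\<close> on the left and
  \<open>s j\<close> on the right.\<close>

lemma eta_s:
  assumes i: "i \<in> I" and j: "j \<in> I" and ij: "i \<noteq> j"
  shows "eta j \<otimes> s i = (if odd (a j i) then sb i else s i) \<otimes> eta j"
proof -
  define x where "x = (if odd (a j i) then sb i else s i)"
  have x: "x \<in> carrier G" using s_closed[OF i] sb_closed[OF i] by (simp add: x_def)
  note cl = s_closed[OF i] sb_closed[OF i] s_closed[OF j] sb_closed[OF j] x
  have "eta j \<otimes> s i = sb j \<otimes> s j \<otimes> s i \<otimes> (s j \<otimes> s j)"
    using cl by (simp add: eta_def s_sb[OF j] s_sq[OF j])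
  also have "\<dots> = sb j \<otimes> (s j \<otimes> s i \<otimes> s j) \<otimes> s j" using cl by (simp add: m_assoc)
  also have "\<dots> = sb j \<otimes> (sb j \<otimes> x \<otimes> sb j) \<otimes> s j"
    using conj_rel[OF i j ij] by (simp add: x_def)
  also have "\<dots> = (sb j \<otimes> sb j) \<otimes> x \<otimes> (sb j \<otimes> s j)" using cl by (simp add: m_assoc)
  also have "\<dots> = x \<otimes> eta j" using cl by (simp add: sb_sq[OF j] eta_def s_sb[OF j])
  finally show ?thesis by (simp add: x_def)
qed

text \<open>Passing \<open>eta j\<close> across \<open>s i\<close> turns it into
  \<open>sb i\<close>, and, \<open>eta j\<close> being an involution, also the other way round.
  Hence \<open>s i \<otimes> sb i\<close> becomes \<open>sb i \<otimes> s i\<close>, which is the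
  same element.\<close>

lemma eta_comm_odd:
  assumes i: "i \<in> I" and j: "j \<in> I" and ij: "i \<noteq> j" and o: "odd (a j i)"
  shows "eta i \<otimes> eta j = eta j \<otimes> eta i"
proof -
  note cl = s_closed[OF i] sb_closed[OF i] eta_closed[OF i] eta_closed[OF j]
  have 1: "eta j \<otimes> s i = sb i \<otimes> eta j" using eta_s[OF i j ij] o by simp
  have "eta j \<otimes> sb i = eta j \<otimes> sb i \<otimes> (eta j \<otimes> eta j)" using cl by (simp add: eta_sq[OF j])
  also have "\<dots> = eta j \<otimes> (sb i \<otimes> eta j) \<otimes> eta j" using cl by (simp add: m_assoc)
  also have "\<dots> = (eta j \<otimes> eta j) \<otimes> s i \<otimes> eta j" using cl by (simp add: 1[symmetric] m_assoc)
  finally have 2: "eta j \<otimes> sb i = s i \<otimes> eta j" using cl by (simp add: eta_sq[OF j])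
  have "eta j \<otimes> eta i = (eta j \<otimes> s i) \<otimes> sb i" using cl by (simp add: eta_def[of i] m_assoc)
  also have "\<dots> = sb i \<otimes> (eta j \<otimes> sb i)" using cl by (simp add: 1 m_assoc)
  also have "\<dots> = (s i \<otimes> sb i) \<otimes> eta j" using cl by (simp add: 2 s_sb[OF i] m_assoc)
  finally show ?thesis by (simp add: eta_def[of i])
qed

text \<open>If both entries are even, neither conjugation relation relates \<open>eta i\<close> and \<open>eta j\<close>; there the
  braid relation gives \<open>eta j \<otimes> eta i = s j \<otimes> s i \<otimes> s j \<otimes> s i\<close>, which commutes with \<open>eta j\<close>.\<close>

lemma eta_comm:
  assumes i: "i \<in> I" and j: "j \<in> I"
  shows "eta i \<otimes> eta j = eta j \<otimes> eta i"
proof (cases "i = j \<or> odd (a i j) \<or> odd (a j i)")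
  case True
  then show ?thesis using eta_comm_odd[OF i j] eta_comm_odd[OF j i] by (cases "i = j") auto
next
  case False
  then have ij: "i \<noteq> j" "even (a i j)" "even (a j i)" by auto
  note cl = s_closed[OF i] sb_closed[OF i] eta_closed[OF i] s_closed[OF j] sb_closed[OF j] eta_closed[OF j]
  have c: "eta j \<otimes> s i = s i \<otimes> eta j" "eta j \<otimes> s j = s j \<otimes> eta j"
    using eta_s[OF i j] s_eta_same[OF j] ij by auto
  have "s i \<otimes> s j = (s j \<otimes> eta j) \<otimes> (eta i \<otimes> s i)"
    using comm_rel[OF i j ij] by (simp add: sb_eq i j s_eta_same)
  then have "s j \<otimes> (s i \<otimes> s j) \<otimes> s i = s j \<otimes> ((s j \<otimes> eta j) \<otimes> (eta i \<otimes> s i)) \<otimes> s i" by simp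
  also have "\<dots> = (s j \<otimes> s j) \<otimes> (eta j \<otimes> eta i) \<otimes> (s i \<otimes> s i)" using cl by (simp add: m_assoc)
  also have "\<dots> = eta j \<otimes> eta i" using cl by (simp add: s_sq i j)
  finally have e: "eta j \<otimes> eta i = s j \<otimes> (s i \<otimes> (s j \<otimes> s i))" using cl by (simp add: m_assoc)
  have C: "eta j \<otimes> (x \<otimes> y) = (x \<otimes> y) \<otimes> eta j"
    if "eta j \<otimes> x = x \<otimes> eta j" "eta j \<otimes> y = y \<otimes> eta j" "x \<in> carrier G" "y \<in> carrier G" for x y
  proof -
    have "eta j \<otimes> (x \<otimes> y) = (eta j \<otimes> x) \<otimes> y" using cl that(3,4) by (simp add: m_assoc)
    also have "\<dots> = x \<otimes> (eta j \<otimes> y)" unfolding that(1) using cl that(3,4) by (simp add: m_assoc)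
    also have "\<dots> = (x \<otimes> y) \<otimes> eta j" unfolding that(2) using cl that(3,4) by (simp add: m_assoc)
    finally show ?thesis .
  qed
  have "eta j \<otimes> (eta j \<otimes> eta i) = (eta j \<otimes> eta i) \<otimes> eta j"
    unfolding e using cl by (intro C c m_closed)
  then have "eta j \<otimes> (eta j \<otimes> eta i) = eta j \<otimes> (eta i \<otimes> eta j)" using cl by (simp add: m_assoc)
  then show ?thesis using cl by simp
qed

lemma s_eta_s:
  assumes i: "i \<in> I" and j: "j \<in> I"
  shows "s i \<otimes> eta j \<otimes> s i = (if i \<noteq> j \<and> odd (a j i) then eta i \<otimes> eta j else eta j)"
proof -
  note cl = s_closed[OF i] sb_closed[OF i] eta_closed[OF i] eta_closed[OF j]
  have "eta j \<otimes> s i = (if i \<noteq> j \<and> odd (a j i) then s i \<otimes> (eta i \<otimes> eta j) else s i \<otimes> eta j)"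
    using eta_s[OF i j] s_eta_same[OF i] cl by (cases "i = j") (auto simp: sb_eq[OF i] m_assoc[symmetric])
  then have "s i \<otimes> (eta j \<otimes> s i) = (if i \<noteq> j \<and> odd (a j i) then (s i \<otimes> s i) \<otimes> (eta i \<otimes> eta j) else (s i \<otimes> s i) \<otimes> eta j)"
    using cl by (simp add: m_assoc)
  then show ?thesis using cl by (simp add: s_sq i j m_assoc)
qed

text \<open>\<open>P\<close> is the indicator of the chosen factors. The list fixes their order, as
  the ambient group is not commutative.\<close>

fun eta_prod :: "'i list \<Rightarrow> ('i \<Rightarrow> bool) \<Rightarrow> 'a" where
  "eta_prod [] P = \<one>"
| "eta_prod (i # xs) P = (if P i then eta i else \<one>) \<otimes> eta_prod xs P"

lemma eta_prod_closed: "set xs \<subseteq> I \<Longrightarrow> eta_prod xs P \<in> carrier G"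
  by (induction xs) (auto simp: eta_closed)

lemma eta_eta_prod: "i \<in> I \<Longrightarrow> set xs \<subseteq> I \<Longrightarrow> eta i \<otimes> eta_prod xs P = eta_prod xs P \<otimes> eta i"
proof (induction xs)
  case (Cons j xs)
  then have cl: "eta i \<in> carrier G" "eta j \<in> carrier G" "eta_prod xs P \<in> carrier G"
    by (auto simp: eta_closed eta_prod_closed)
  have "eta i \<otimes> (eta j \<otimes> eta_prod xs P) = (eta i \<otimes> eta j) \<otimes> eta_prod xs P" using cl by (simp add: m_assoc)
  also have "\<dots> = eta j \<otimes> (eta i \<otimes> eta_prod xs P)"
    using cl Cons.prems eta_comm[of i j] by (simp add: m_assoc)
  also have "\<dots> = (eta j \<otimes> eta_prod xs P) \<otimes> eta i" using cl Cons by (simp add: m_assoc)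
  finally show ?case using Cons cl by simp
qed (simp add: eta_closed)

text \<open>Commuting involutions: the exponents add modulo 2, which is inequality of truth
  values.\<close>

lemma eta_prod_mult:
  "set xs \<subseteq> I \<Longrightarrow> eta_prod xs P \<otimes> eta_prod xs Q = eta_prod xs (\<lambda>i. P i \<noteq> Q i)"
proof (induction xs)
  case (Cons i xs)
  define p q where "p = (if P i then eta i else \<one>)" and "q = (if Q i then eta i else \<one>)"
  have cl: "p \<in> carrier G" "q \<in> carrier G" "eta_prod xs P \<in> carrier G" "eta_prod xs Q \<in> carrier G"
    using Cons.prems by (auto simp: eta_closed eta_prod_closed p_def q_def)
  have c: "eta_prod xs P \<otimes> q = q \<otimes> eta_prod xs P"
    using Cons.prems cl eta_eta_prod[of i xs P] by (auto simp: q_def)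
  have "(p \<otimes> eta_prod xs P) \<otimes> (q \<otimes> eta_prod xs Q) = p \<otimes> (eta_prod xs P \<otimes> q) \<otimes> eta_prod xs Q"
    using cl by (simp add: m_assoc)
  also have "\<dots> = (p \<otimes> q) \<otimes> (eta_prod xs P \<otimes> eta_prod xs Q)"
    unfolding c using cl by (simp add: m_assoc)
  also have "p \<otimes> q = (if P i \<noteq> Q i then eta i else \<one>)"
    using Cons.prems by (auto simp: p_def q_def eta_sq eta_closed)
  finally show ?case using Cons by (simp add: p_def q_def)
qed simp

lemma eta_prod_single:
  "distinct xs \<Longrightarrow> set xs \<subseteq> I \<Longrightarrow> eta_prod xs (\<lambda>j. j = i) = (if i \<in> set xs then eta i else \<one>)"
  by (induction xs) (auto simp: eta_closed)

lemma subgroup_eta_prod: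
  assumes "set xs \<subseteq> I"
  shows "subgroup (range (eta_prod xs)) G"
proof (rule subgroupI)
  have id: "eta_prod xs (\<lambda>_. False) = \<one>" using assms by (induction xs) auto
  fix x assume "x \<in> range (eta_prod xs)"
  then obtain P where P: "x = eta_prod xs P" by auto
  have "x \<otimes> x = \<one>" using eta_prod_mult[OF assms, of P P] id P by simp
  then have "inv x = x" using inv_equality eta_prod_closed[OF assms] P by simp
  then show "inv x \<in> range (eta_prod xs)" using P by simp
  fix y assume "y \<in> range (eta_prod xs)"
  then show "x \<otimes> y \<in> range (eta_prod xs)" using P eta_prod_mult[OF assms] by auto
qed (use assms eta_prod_closed in auto)

lemma s_conj_eta_prod:
  assumes xs: "distinct xs" "set xs = I" and i: "i \<in> I" and x: "x \<in> range (eta_prod xs)"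
  shows "s i \<otimes> x \<otimes> s i \<in> range (eta_prod xs)"
proof -
  interpret N: subgroup "range (eta_prod xs)" G using subgroup_eta_prod xs(2) by blast
  have eta: "eta j \<in> range (eta_prod xs)" if "j \<in> I" for j
    using eta_prod_single[OF xs(1), of j] xs(2) that by (metis order.refl rangeI)
  obtain P where P: "x = eta_prod xs P" using x by auto
  \<comment> \<open>Only \<open>ys\<close> shrinks in the induction. The target stays the full
    subgroup for \<open>xs\<close>, because conjugation can produce a factor \<open>eta i\<close>
    with \<open>i\<close> outside \<open>ys\<close>.\<close>
  have "s i \<otimes> eta_prod ys P \<otimes> s i \<in> range (eta_prod xs)" if "set ys \<subseteq> I" for ys
    using that
  proof (induction ys)
    case Nil
    then show ?case using s_closed[OF i] s_sq[OF i] by simp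
  next
    case (Cons j ys)
    define p where "p = (if P j then eta j else \<one>)"
    have cl: "s i \<in> carrier G" "p \<in> carrier G" "eta_prod ys P \<in> carrier G"
      using Cons.prems i by (auto simp: p_def eta_closed s_closed eta_prod_closed)
    have "s i \<otimes> (p \<otimes> eta_prod ys P) \<otimes> s i = s i \<otimes> p \<otimes> (s i \<otimes> s i) \<otimes> eta_prod ys P \<otimes> s i"
      using cl by (simp add: s_sq[OF i] m_assoc)
    also have "\<dots> = (s i \<otimes> p \<otimes> s i) \<otimes> (s i \<otimes> eta_prod ys P \<otimes> s i)"
      using cl by (simp add: m_assoc)
    also have "\<dots> \<in> range (eta_prod xs)"
    proof (rule N.m_closed)
      show "s i \<otimes> p \<otimes> s i \<in> range (eta_prod xs)"
        using s_eta_s[OF i, of j] eta i Cons.prems s_closed[OF i] s_sq[OF i]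
        by (auto simp: p_def intro: N.m_closed)
    qed (use Cons in auto)
    finally show ?case by (simp add: p_def)
  qed
  then show ?thesis using P xs(2) by simp
qed

end


section \<open>The two presentations, the projection between them, and the action on states\<close>

definition weyl_rels :: "'i set \<Rightarrow> ('i \<Rightarrow> 'i \<Rightarrow> int) \<Rightarrow> ('i list \<times> 'i list) set" where
  "weyl_rels I a = {([i, i], []) | i. i \<in> I} \<union>
      {(alternating (braid_length a i j) i j, alternating (braid_length a i j) j i) | i j.
         i \<in> I \<and> j \<in> I \<and> i \<noteq> j}"

definition weyl_U_rels :: "'i set \<Rightarrow> ('i \<Rightarrow> 'i \<Rightarrow> int) \<Rightarrow> ('i ugen list \<times> 'i ugen list) set" where
  "weyl_U_rels I a = {([Sig i, Sig i], []) | i. i \<in> I} \<union>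
      {([SigBar i, SigBar i], []) | i. i \<in> I} \<union>
      {([Sig i, SigBar i], [SigBar i, Sig i]) | i. i \<in> I} \<union>
      {([Sig j, Sig i, Sig j],
        [SigBar j, (swap_bar ^^ nat (1 - a j i)) (SigBar i), SigBar j]) | i j.
         i \<in> I \<and> j \<in> I \<and> i \<noteq> j} \<union>
      {(alternating (braid_length a i j) (Sig i) (Sig j),
        alternating (braid_length a i j) (SigBar j) (SigBar i)) | i j.
         i \<in> I \<and> j \<in> I \<and> i \<noteq> j}"

abbreviation ugens :: "'i set \<Rightarrow> 'i ugen set" where
  "ugens I \<equiv> Sig ` I \<union> SigBar ` I"

abbreviation U_eq :: "'i set \<Rightarrow> ('i \<Rightarrow> 'i \<Rightarrow> int) \<Rightarrow> ('i ugen \<times> bool) list \<Rightarrow> ('i ugen \<times> bool) list \<Rightarrow> bool" where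
  "U_eq I a \<equiv> word_eq (ugens I) (pos_relations (weyl_U_rels I a))"

abbreviation W_eq :: "'i set \<Rightarrow> ('i \<Rightarrow> 'i \<Rightarrow> int) \<Rightarrow> ('i \<times> bool) list \<Rightarrow> ('i \<times> bool) list \<Rightarrow> bool" where
  "W_eq I a \<equiv> word_eq I (pos_relations (weyl_rels I a))"

abbreviation U_class :: "'i set \<Rightarrow> ('i \<Rightarrow> 'i \<Rightarrow> int) \<Rightarrow> ('i ugen \<times> bool) list \<Rightarrow> ('i ugen \<times> bool) list set" where
  "U_class I a \<equiv> word_class (ugens I) (pos_relations (weyl_U_rels I a))"

abbreviation W_class :: "'i set \<Rightarrow> ('i \<Rightarrow> 'i \<Rightarrow> int) \<Rightarrow> ('i \<times> bool) list \<Rightarrow> ('i \<times> bool) list set" where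
  "W_class I a \<equiv> word_class I (pos_relations (weyl_rels I a))"

lemma pos_relations_cases:
  assumes "(u, v) \<in> pos_relations R"
  obtains u' v' where "(u', v') \<in> R" "u = pos_word u'" "v = pos_word v'"
  using assms by (auto simp: pos_relations_def)

lemma W_eq_square: "i \<in> I \<Longrightarrow> W_eq I a (pos_word [i, i]) (pos_word [])"
  by (rule word_eq_pos_relations) (auto simp: weyl_rels_def)

lemma W_eq_braid:
  assumes "i \<in> I" "j \<in> I" "i \<noteq> j"
  shows "W_eq I a (pos_word (alternating (braid_length a i j) i j)) (pos_word (alternating (braid_length a i j) j i))"
  using assms set_alternating[of "braid_length a i j" i j] set_alternating[of "braid_length a i j" j i]
  by (intro word_eq_pos_relations) (unfold weyl_rels_def, blast+)

lemma U_eq_intros: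
  "i \<in> I \<Longrightarrow> U_eq I a (pos_word [Sig i, Sig i]) (pos_word [])"
  "i \<in> I \<Longrightarrow> U_eq I a (pos_word [SigBar i, SigBar i]) (pos_word [])"
  "i \<in> I \<Longrightarrow> U_eq I a (pos_word [Sig i, SigBar i]) (pos_word [SigBar i, Sig i])"
  "i \<in> I \<Longrightarrow> j \<in> I \<Longrightarrow> i \<noteq> j \<Longrightarrow> U_eq I a (pos_word [Sig j, Sig i, Sig j])
     (pos_word [SigBar j, (swap_bar ^^ nat (1 - a j i)) (SigBar i), SigBar j])"
  by (rule word_eq_pos_relations; force simp: weyl_U_rels_def swap_bar_funpow)+

lemma U_eq_braid:
  assumes "i \<in> I" "j \<in> I" "i \<noteq> j"
  shows "U_eq I a (pos_word (alternating (braid_length a i j) (Sig i) (Sig j)))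
     (pos_word (alternating (braid_length a i j) (SigBar j) (SigBar i)))"
  using assms set_alternating[of "braid_length a i j" "Sig i" "Sig j"]
    set_alternating[of "braid_length a i j" "SigBar j" "SigBar i"]
  by (intro word_eq_pos_relations) (unfold weyl_U_rels_def, blast+)

lemma U_rel_cases:
  assumes "(u, v) \<in> pos_relations (weyl_U_rels I a)"
  obtains i where "i \<in> I" "u = pos_word [Sig i, Sig i]" "v = []"
  | i where "i \<in> I" "u = pos_word [SigBar i, SigBar i]" "v = []"
  | i where "i \<in> I" "u = pos_word [Sig i, SigBar i]" "v = pos_word [SigBar i, Sig i]"
  | i j where "i \<in> I" "j \<in> I" "i \<noteq> j" "u = pos_word [Sig j, Sig i, Sig j]"
      "v = pos_word [SigBar j, (swap_bar ^^ nat (1 - a j i)) (SigBar i), SigBar j]"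
  | i j where "i \<in> I" "j \<in> I" "i \<noteq> j" "u = pos_word (alternating (braid_length a i j) (Sig i) (Sig j))"
      "v = pos_word (alternating (braid_length a i j) (SigBar j) (SigBar i))"
  using assms unfolding weyl_U_rels_def by (elim pos_relations_cases UnE) auto

lemma W_rel_cases:
  assumes "(u, v) \<in> pos_relations (weyl_rels I a)"
  obtains i where "i \<in> I" "u = pos_word [i, i]" "v = []"
  | i j where "i \<in> I" "j \<in> I" "i \<noteq> j" "u = pos_word (alternating (braid_length a i j) i j)"
      "v = pos_word (alternating (braid_length a i j) j i)"
  using assms unfolding weyl_rels_def by (elim pos_relations_cases UnE) auto

text \<open>Without bars the commutation and conjugation relations become identities, and the other
  families become the Coxeter relations.\<close>

lemma U_eq_imp_W_eq:
  assumes "(u, v) \<in> pos_relations (weyl_U_rels I a)"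
  shows "W_eq I a (map_word ugen_index u) (map_word ugen_index v)"
  using assms
proof (cases rule: U_rel_cases)
  case (1 i)
  then show ?thesis using W_eq_square[of i I a] by simp
next
  case (2 i)
  then show ?thesis using W_eq_square[of i I a] by simp
next
  case (3 i)
  then show ?thesis by (auto intro: word_eq.refl)
next
  case (4 i j)
  then show ?thesis by (auto intro: word_eq.refl simp: swap_bar_funpow)
next
  case (5 i j)
  then show ?thesis using W_eq_braid[of i I j a] by (simp add: map_word_pos_word map_alternating)
qed

text \<open>The exponent flag is ignored since a generator and its inverse are to act alike.\<close>

definition letter_act :: "('i \<Rightarrow> 'i \<Rightarrow> int) \<Rightarrow> 'i ugen \<times> bool \<Rightarrow> 'i ustate \<Rightarrow> 'i ustate" where
  "letter_act a x = (case fst x of Sig i \<Rightarrow> uact a False i | SigBar i \<Rightarrow> uact a True i)"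

lemma fold_pos_word: "fold (letter_act a) (pos_word xs) = fold (\<lambda>x. letter_act a (x, True)) xs"
  by (induction xs) auto

lemma fold_Sig: "fold (\<lambda>x. letter_act a (x, True)) (map Sig xs) = fold (uact a False) xs"
  and fold_SigBar: "fold (\<lambda>x. letter_act a (x, True)) (map SigBar xs) = fold (uact a True) xs"
  by (induction xs) (auto simp: letter_act_def)

text \<open>The three facts about the Cartan matrix on which the rest of the argument rests.\<close>

locale finite_type_matrix =
  fixes I :: "'i set" and a :: "'i \<Rightarrow> 'i \<Rightarrow> int"
  assumes finite_I: "finite I" and diag: "i \<in> I \<Longrightarrow> a i i = 2"
    and entries: "i \<in> I \<Longrightarrow> j \<in> I \<Longrightarrow> i \<noteq> j \<Longrightarrow>
      (a i j, a j i) \<in> {(0,0), (-1,-1), (-1,-2), (-2,-1), (-1,-3), (-3,-1)}"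
begin

lemma even_exponent:
  assumes "i \<in> I" "j \<in> I" "i \<noteq> j"
  shows "even (nat (1 - a j i)) \<longleftrightarrow> odd (a j i)"
  using entries[OF assms] by auto

definition regular :: "'i ustate \<Rightarrow> bool" where
  "regular st \<longleftrightarrow> indep_family I (fst st)"

lemma regular_letter_act: "fst x \<in> ugens I \<Longrightarrow> regular st \<Longrightarrow> regular (letter_act a x st)"
  using indep_family_refl_step[OF finite_I] diag
  by (cases st) (auto simp: regular_def letter_act_def uact_def)

lemma regular_fold_letter_act: "u \<in> group_words (ugens I) \<Longrightarrow> regular st \<Longrightarrow> regular (fold (letter_act a) u st)"
  by (induction u arbitrary: st) (auto simp: regular_letter_act)

text \<open>Each defining relation holds on regular states. All regular \<open>st\<close> are
  treated at once, because under \<open>append\<close> the second word acts on the state reached by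
  the first.\<close>

lemma U_eq_fold_letter_act:
  assumes "U_eq I a u v" "regular st"
  shows "fold (letter_act a) u st = fold (letter_act a) v st"
  using assms
proof (induction arbitrary: st rule: word_eq.induct)
  case (append u v u' v')
  then show ?case using regular_fold_letter_act word_eq_group_words[OF append(1)] by auto
next
  case (cancel x b)
  then show ?case
    by (cases st) (auto simp: letter_act_def uact_uact diag)
next
  case (rel u v)
  obtain A C w where st: "st = (A, C, w)" by (cases st)
  from rel(1) show ?case
  proof (cases rule: U_rel_cases)
    case (4 i j)
    then show ?thesis using uact_conj[of a i j st] even_exponent[OF 4(1-3)] diag
      by (auto simp: letter_act_def swap_bar_funpow)
  next
    case (5 i j)
    have "indep_family I A" using rel.prems st by (simp add: regular_def)
    then show ?thesis
      using uact_braid[OF finite_I _ 5(1-3) diag[OF 5(1)] diag[OF 5(2)] entries[OF 5(1-3)]]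
      by (simp add: 5(4,5) st fold_pos_word fold_Sig fold_SigBar flip: map_alternating)
  qed (auto simp: st letter_act_def uact_uact diag)
qed auto


section \<open>The normal subgroup \<open>N\<close> and cosets modulo \<open>N\<close>\<close>

abbreviation W where "W \<equiv> weyl_group I a"
abbreviation U where "U \<equiv> weyl_group_U I a"

lemma W_def: "W = presented_group I (pos_relations (weyl_rels I a))"
  by (simp add: weyl_group_def weyl_rels_def)

lemma U_def: "U = presented_group (ugens I) (pos_relations (weyl_U_rels I a))"
  by (simp add: weyl_group_U_def weyl_U_rels_def)

lemma group_W: "group W" and group_U: "group U"
  by (simp_all add: W_def U_def group_presented_group)

lemma U_class_mult:
  "u \<in> group_words (ugens I) \<Longrightarrow> v \<in> group_words (ugens I) \<Longrightarrow>
    U_class I a u \<otimes>\<^bsub>U\<^esub> U_class I a v = U_class I a (u @ v)"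
  unfolding U_def by (rule mult_presented_group)

lemma U_class_Nil: "U_class I a [] = \<one>\<^bsub>U\<^esub>"
  unfolding U_def one_presented_group ..

lemma U_class_closed: "u \<in> group_words (ugens I) \<Longrightarrow> U_class I a u \<in> carrier U"
  unfolding U_def by (rule word_class_in_carrier)

lemma U_class_eqI: "U_eq I a u v \<Longrightarrow> U_class I a u = U_class I a v"
  using word_class_eq_iff word_eq_group_words by blast

sublocale U: unitary_generators U I a "\<lambda>i. U_class I a [(Sig i, True)]" "\<lambda>i. U_class I a [(SigBar i, True)]"
proof -
  interpret group U by (rule group_U)
  show "unitary_generators U I a (\<lambda>i. U_class I a [(Sig i, True)]) (\<lambda>i. U_class I a [(SigBar i, True)])"
  proof
    fix i assume i: "i \<in> I"
    show "U_class I a [(Sig i, True)] \<in> carrier U" "U_class I a [(SigBar i, True)] \<in> carrier U"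
      using i by (auto intro!: U_class_closed)
    show "U_class I a [(Sig i, True)] \<otimes>\<^bsub>U\<^esub> U_class I a [(Sig i, True)] = \<one>\<^bsub>U\<^esub>"
      "U_class I a [(SigBar i, True)] \<otimes>\<^bsub>U\<^esub> U_class I a [(SigBar i, True)] = \<one>\<^bsub>U\<^esub>"
      "U_class I a [(Sig i, True)] \<otimes>\<^bsub>U\<^esub> U_class I a [(SigBar i, True)] =
       U_class I a [(SigBar i, True)] \<otimes>\<^bsub>U\<^esub> U_class I a [(Sig i, True)]"
      using i U_eq_intros(1-3)[OF i, of a] by (auto simp: U_class_mult U_class_Nil[symmetric] intro!: U_class_eqI)
    fix j assume j: "j \<in> I" and ij: "i \<noteq> j"
    show "U_class I a [(Sig j, True)] \<otimes>\<^bsub>U\<^esub> U_class I a [(Sig i, True)] \<otimes>\<^bsub>U\<^esub> U_class I a [(Sig j, True)] =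
      U_class I a [(SigBar j, True)] \<otimes>\<^bsub>U\<^esub> (if odd (a j i) then U_class I a [(SigBar i, True)]
        else U_class I a [(Sig i, True)]) \<otimes>\<^bsub>U\<^esub> U_class I a [(SigBar j, True)]"
      using i j U_eq_intros(4)[OF i j ij, of a] even_exponent[OF i j ij]
      by (auto simp: U_class_mult swap_bar_funpow intro!: U_class_eqI)
    assume "even (a i j)" "even (a j i)"
    then have "braid_length a i j = 2" using entries[OF i j ij] by (auto simp: braid_length_def)
    then show "U_class I a [(Sig i, True)] \<otimes>\<^bsub>U\<^esub> U_class I a [(Sig j, True)] =
       U_class I a [(SigBar j, True)] \<otimes>\<^bsub>U\<^esub> U_class I a [(SigBar i, True)]"
      using i j U_eq_braid[OF i j ij, of a]
      by (auto simp: U_class_mult numeral_2_eq_2 intro!: U_class_eqI)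
  qed
qed

lemma U_class_letter:
  assumes "x \<in> ugens I"
  shows "U_class I a [(x, b)] = U_class I a [(x, True)]"
proof (cases b)
  case False
  have "U_eq I a (pos_word [x, x]) []" using assms U_eq_intros(1,2)[of _ I a] by auto
  then have "U_eq I a ([(x, False)] @ pos_word [x, x]) ([(x, False)] @ [])"
    using assms by (intro word_eq.append word_eq.refl) auto
  moreover have "U_eq I a ([(x, False), (x, \<not> False)] @ [(x, True)]) ([] @ [(x, True)])"
    using assms by (intro word_eq.append word_eq.refl word_eq.cancel) auto
  ultimately have "U_eq I a [(x, False)] [(x, True)]"
    by (auto intro: word_eq.sym word_eq.trans)
  then show ?thesis using False by (simp add: U_class_eqI)
qed simp

definition index_list :: "'i list" where
  "index_list = (SOME xs. set xs = I \<and> distinct xs)"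

lemma index_list: "set index_list = I" "distinct index_list"
  using someI_ex[OF finite_distinct_list[OF finite_I]] by (simp_all add: index_list_def)

definition N :: "('i ugen \<times> bool) list set set" where
  "N = range (U.eta_prod index_list)"

lemma subgroup_N: "subgroup N U"
  unfolding N_def by (rule U.subgroup_eta_prod) (simp add: index_list)

lemma eta_in_N: "i \<in> I \<Longrightarrow> U.eta i \<in> N"
  using U.eta_prod_single[of index_list i] by (auto simp: N_def index_list intro!: range_eqI[symmetric])

lemma U_induct [consumes 1, case_names one mult]:
  assumes "x \<in> carrier U" and "P \<one>\<^bsub>U\<^esub>"
    and "\<And>g x. g \<in> ugens I \<Longrightarrow> x \<in> carrier U \<Longrightarrow> P x \<Longrightarrow> P (U_class I a [(g, True)] \<otimes>\<^bsub>U\<^esub> x)"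
  shows "P x"
proof -
  obtain u where u: "u \<in> group_words (ugens I)" "x = U_class I a u"
    using assms(1) by (auto simp: U_def carrier_presented_group)
  from u(1) have "P (U_class I a u)"
  proof (induction u)
    case (Cons y u)
    then have "U_class I a (y # u) = U_class I a [(fst y, snd y)] \<otimes>\<^bsub>U\<^esub> U_class I a u"
      by (simp add: U_class_mult)
    also have "U_class I a [(fst y, snd y)] = U_class I a [(fst y, True)]"
      using Cons.prems by (intro U_class_letter) simp
    finally show ?case using Cons assms(3) by (simp add: U_class_closed)
  qed (simp add: U_class_Nil assms(2))
  then show ?thesis using u(2) by simp
qed

text \<open>It suffices to conjugate by generators, which are their own inverses. A barred generator
  is \<open>eta i\<close> times the unbarred one, in either order, so its conjugation is one by
  \<open>eta i\<close> inside \<open>N\<close> followed by one by the unbarred generator.\<close>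

lemma conj_N:
  assumes "x \<in> carrier U" and "n \<in> N"
  shows "x \<otimes>\<^bsub>U\<^esub> n \<otimes>\<^bsub>U\<^esub> inv\<^bsub>U\<^esub> x \<in> N"
  using assms(1)
proof (induction rule: U_induct)
  case one
  have "n \<in> carrier U" using assms(2) subgroup.subset[OF subgroup_N] by blast
  then show ?case using assms(2) by simp
next
  case (mult g x)
  define t where "t = U_class I a [(g, True)]"
  define m where "m = x \<otimes>\<^bsub>U\<^esub> n \<otimes>\<^bsub>U\<^esub> inv\<^bsub>U\<^esub> x"
  interpret N: subgroup N U by (rule subgroup_N)
  have "n \<in> carrier U" using assms(2) N.subset by blast
  moreover have "t \<in> carrier U" unfolding t_def using mult(1) by (intro U_class_closed) simp
  ultimately have cl: "t \<in> carrier U" "x \<in> carrier U" "n \<in> carrier U" "m \<in> carrier U"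
    using mult(2) by (simp_all add: m_def)
  have S: "U_class I a [(Sig i, True)] \<otimes>\<^bsub>U\<^esub> y \<otimes>\<^bsub>U\<^esub> U_class I a [(Sig i, True)] \<in> N" if "i \<in> I" "y \<in> N" for i y
    using U.s_conj_eta_prod[OF index_list(2,1)] that by (simp add: N_def)
  have tt: "t \<otimes>\<^bsub>U\<^esub> t = \<one>\<^bsub>U\<^esub>" using mult(1) U.s_sq U.sb_sq by (auto simp: t_def)
  then have "inv\<^bsub>U\<^esub> t = t" using cl by (simp add: U.inv_equality)
  then have "(t \<otimes>\<^bsub>U\<^esub> x) \<otimes>\<^bsub>U\<^esub> n \<otimes>\<^bsub>U\<^esub> inv\<^bsub>U\<^esub> (t \<otimes>\<^bsub>U\<^esub> x) = t \<otimes>\<^bsub>U\<^esub> m \<otimes>\<^bsub>U\<^esub> t"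
    using cl by (simp add: m_def U.inv_mult_group U.m_assoc)
  also have "\<dots> \<in> N"
    using mult(1)
  proof
    assume "g \<in> Sig ` I"
    then show ?thesis using S mult(3) by (auto simp: t_def m_def)
  next
    assume "g \<in> SigBar ` I"
    then obtain i where i: "i \<in> I" "g = SigBar i" by auto
    define r where "r = U_class I a [(Sig i, True)]"
    have r: "r \<in> carrier U" "U.eta i \<in> carrier U" using i U.s_closed U.eta_closed by (auto simp: r_def)
    have t: "t = r \<otimes>\<^bsub>U\<^esub> U.eta i" "t = U.eta i \<otimes>\<^bsub>U\<^esub> r"
      using U.sb_eq[OF i(1)] U.s_eta_same[OF i(1)] by (simp_all add: t_def r_def i(2))
    have "t \<otimes>\<^bsub>U\<^esub> m \<otimes>\<^bsub>U\<^esub> t = r \<otimes>\<^bsub>U\<^esub> (U.eta i \<otimes>\<^bsub>U\<^esub> m \<otimes>\<^bsub>U\<^esub> U.eta i) \<otimes>\<^bsub>U\<^esub> r"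
      by (subst (2) t(2), subst t(1)) (use r cl in \<open>simp add: U.m_assoc\<close>)
    also have "\<dots> \<in> N"
      unfolding r_def using mult(3) eta_in_N[OF i(1)] by (intro S i(1) N.m_closed) (simp_all add: m_def)
    finally show ?thesis .
  qed
  finally show ?case by (simp add: t_def)
qed

lemma normal_N: "N \<lhd> U"
  using conj_N subgroup_N U.normal_inv_iff by blast

lemma N_coset_ugen_index:
  assumes "u \<in> group_words (ugens I)"
  shows "N #>\<^bsub>U\<^esub> U_class I a (map_word (\<lambda>g. Sig (ugen_index g)) u) = N #>\<^bsub>U\<^esub> U_class I a u"
  using assms
proof (induction u)
  case (Cons y u)
  interpret N: normal N U by (rule normal_N)
  obtain g b where y: "y = (g, b)" by (cases y)
  have g: "g \<in> ugens I" and u: "u \<in> group_words (ugens I)" using Cons.prems y by auto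
  define v where "v = map_word (\<lambda>g. Sig (ugen_index g)) u"
  have v: "v \<in> group_words (ugens I)"
    unfolding v_def using u by (rule map_word_in_group_words) auto
  have g': "Sig (ugen_index g) \<in> ugens I" using g by auto
  have "N #>\<^bsub>U\<^esub> U_class I a [(Sig (ugen_index g), b)] = N #>\<^bsub>U\<^esub> U_class I a [(g, b)]"
    unfolding U_class_letter[OF g, of b] U_class_letter[OF g', of b]
    using g
  proof
    assume "g \<in> SigBar ` I"
    then obtain i where i: "i \<in> I" "g = SigBar i" by auto
    have "U_class I a [(g, True)] = U.eta i \<otimes>\<^bsub>U\<^esub> U_class I a [(Sig i, True)]"
      using U.sb_eq[OF i(1)] U.s_eta_same[OF i(1)] i(2) by simp
    then have "U_class I a [(g, True)] \<in> N #>\<^bsub>U\<^esub> U_class I a [(Sig i, True)]"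
      using eta_in_N[OF i(1)] by (auto simp: r_coset_def)
    then show "N #>\<^bsub>U\<^esub> U_class I a [(Sig (ugen_index g), True)] = N #>\<^bsub>U\<^esub> U_class I a [(g, True)]"
      using U.repr_independence[OF _ _ subgroup_N] U.s_closed[OF i(1)] i(2) by simp
  qed auto
  then have "(N #>\<^bsub>U\<^esub> U_class I a [(Sig (ugen_index g), b)]) <#>\<^bsub>U\<^esub> (N #>\<^bsub>U\<^esub> U_class I a v) =
      (N #>\<^bsub>U\<^esub> U_class I a [(g, b)]) <#>\<^bsub>U\<^esub> (N #>\<^bsub>U\<^esub> U_class I a u)"
    by (simp only: v_def Cons.IH[OF u])
  then show ?case
    using u v g g' by (simp add: y N.rcos_sum U_class_closed U_class_mult flip: v_def)
qed simp

text \<open>This makes \<open>Sig\<close> induce a map from the Weyl group to the quotient by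
  \<open>N\<close>, which bounds the kernel of the projection. The Coxeter braid relation is the one
  of \<open>U\<close> with the bars on its right side dropped modulo \<open>N\<close>.\<close>

lemma W_eq_imp_N_coset:
  assumes "W_eq I a u v"
  shows "N #>\<^bsub>U\<^esub> U_class I a (map_word Sig u) = N #>\<^bsub>U\<^esub> U_class I a (map_word Sig v)"
  using assms
proof (induction rule: word_eq.induct)
  case (append u v u' v')
  interpret N: normal N U by (rule normal_N)
  have "w \<in> group_words I \<Longrightarrow> map_word Sig w \<in> group_words (ugens I)" for w
    by (erule map_word_in_group_words) auto
  then have cl: "map_word Sig u \<in> group_words (ugens I)" "map_word Sig v \<in> group_words (ugens I)"
      "map_word Sig u' \<in> group_words (ugens I)" "map_word Sig v' \<in> group_words (ugens I)"
    using word_eq_group_words[OF append(1)] word_eq_group_words[OF append(2)] by auto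
  have "(N #>\<^bsub>U\<^esub> U_class I a (map_word Sig u)) <#>\<^bsub>U\<^esub> (N #>\<^bsub>U\<^esub> U_class I a (map_word Sig u')) =
    (N #>\<^bsub>U\<^esub> U_class I a (map_word Sig v)) <#>\<^bsub>U\<^esub> (N #>\<^bsub>U\<^esub> U_class I a (map_word Sig v'))"
    using append by simp
  then show ?case using cl by (simp add: N.rcos_sum U_class_closed U_class_mult)
next
  case (cancel s b)
  have "U_eq I a [(Sig s, b), (Sig s, \<not> b)] []" using cancel by (intro word_eq.cancel) auto
  from U_class_eqI[OF this] show ?case by simp
next
  case (rel u v)
  from rel(1) show ?case
  proof (cases rule: W_rel_cases)
    case (1 i)
    then show ?thesis using U_class_eqI[OF U_eq_intros(1)[of i I a]] by simp
  next
    case (2 i j)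
    let ?w = "pos_word (alternating (braid_length a i j) (SigBar j) (SigBar i))"
    have "?w \<in> group_words (ugens I)" using U_eq_braid[OF 2(1-3), of a] word_eq_group_words by blast
    from N_coset_ugen_index[OF this] show ?thesis
      using U_class_eqI[OF U_eq_braid[OF 2(1-3), of a]]
      by (simp add: 2(4,5) map_word_pos_word map_alternating)
  qed
qed auto

section \<open>Independence of the elements \<open>eta i\<close>, and the exact sequence\<close>

fun eta_word :: "'i list \<Rightarrow> ('i \<Rightarrow> bool) \<Rightarrow> ('i ugen \<times> bool) list" where
  "eta_word [] P = []"
| "eta_word (i # xs) P = (if P i then [(Sig i, True), (SigBar i, True)] else []) @ eta_word xs P"

lemma eta_word_in_group_words: "set xs \<subseteq> I \<Longrightarrow> eta_word xs P \<in> group_words (ugens I)"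
  by (induction xs) auto

lemma eta_prod_eq_U_class: "set xs \<subseteq> I \<Longrightarrow> U.eta_prod xs P = U_class I a (eta_word xs P)"
  by (induction xs)
    (auto simp: U_class_Nil U.eta_def U_class_mult eta_word_in_group_words U_class_closed)

text \<open>Each factor leaves \<open>A\<close> and \<open>C\<close> alone and adds the unit vector
  \<open>C i\<close> to \<open>v\<close>, so \<open>v\<close> records \<open>P\<close> on the
  list.\<close>

lemma fold_eta_word:
  assumes "distinct xs" "set xs \<subseteq> I" and C: "C = (\<lambda>i k. if i = k then 1 else 0)"
  shows "fold (letter_act a) (eta_word xs P) (A, C, v) = (A, C, \<lambda>k. v k \<noteq> (k \<in> set xs \<and> P k))"
  using assms(1,2)
proof (induction xs arbitrary: v)
  case (Cons i xs)
  then show ?case by (auto simp: letter_act_def uact_uact diag C fun_eq_iff)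
qed simp

text \<open>Equal products act equally on a regular state, and started at the identity of the Weyl
  group the action reveals the exponents.\<close>

lemma eta_prod_inj:
  assumes "U.eta_prod index_list P = U.eta_prod index_list Q" and k: "k \<in> I"
  shows "P k \<longleftrightarrow> Q k"
proof -
  \<comment> \<open>Unit vectors represent both the simple roots and the simple coroots in the
    starting state.\<close>
  define C where "C = (\<lambda>(i::'i) k. if i = k then 1 else (0::int))"
  have "U_class I a (eta_word index_list P) = U_class I a (eta_word index_list Q)"
    using assms(1) by (simp add: eta_prod_eq_U_class index_list)
  then have "U_eq I a (eta_word index_list P) (eta_word index_list Q)"
    using word_class_eq_iff[OF eta_word_in_group_words[of index_list P]] index_list(1) by simp
  moreover have "regular (C, C, \<lambda>_. False)"
    unfolding regular_def indep_family_def
  proof (intro allI impI ballI)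
    fix n j assume n: "\<forall>k. (\<Sum>j\<in>I. n j * fst (C, C, \<lambda>_. False) j k) = 0" and "j \<in> I"
    have "(\<Sum>l\<in>I. n l * C l j) = (\<Sum>l\<in>I. if l = j then n l else 0)"
      by (rule sum.cong) (auto simp: C_def)
    then show "n j = 0" using n finite_I \<open>j \<in> I\<close> by simp
  qed
  ultimately have "fold (letter_act a) (eta_word index_list P) (C, C, \<lambda>_. False) =
      fold (letter_act a) (eta_word index_list Q) (C, C, \<lambda>_. False)"
    by (rule U_eq_fold_letter_act)
  then have "(\<lambda>k. k \<in> I \<and> P k) = (\<lambda>k. k \<in> I \<and> Q k)"
    using fold_eta_word[OF index_list(2) _ C_def] index_list(1) by simp
  then show ?thesis using k by meson
qed

lemma short_exact_weyl_group_U: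
  "\<exists>\<iota> \<pi>. short_exact (product_group I (\<lambda>_. integer_mod_group 2)) U W \<iota> \<pi>"
proof -
  let ?Z = "product_group I (\<lambda>_. integer_mod_group 2)"
  \<comment> \<open>The elements of \<open>integer_mod_group 2\<close> are the integers 0 and 1, so
    \<open>f i = 1\<close> selects the factors.\<close>
  define \<iota> where "\<iota> f = U.eta_prod index_list (\<lambda>i. f i = 1)" for f :: "'i \<Rightarrow> int"
  obtain \<pi> where \<pi>_hom: "\<pi> \<in> hom U W"
    and \<pi>: "\<And>u. u \<in> group_words (ugens I) \<Longrightarrow> \<pi> (U_class I a u) = W_class I a (map_word ugen_index u)"
    using presented_group_hom_exists[of ugen_index "ugens I" I "pos_relations (weyl_U_rels I a)"
        "pos_relations (weyl_rels I a)"] U_eq_imp_W_eq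
    unfolding U_def W_def by force
  have Z: "f \<in> carrier ?Z \<longleftrightarrow> f \<in> extensional I \<and> (\<forall>i\<in>I. f i = 0 \<or> f i = 1)" for f
    by (auto simp: carrier_integer_mod_group PiE_def Pi_def)
  have \<iota>_hom: "\<iota> \<in> hom ?Z U"
  proof (rule homI)
    fix f g assume f: "f \<in> carrier ?Z" and g: "g \<in> carrier ?Z"
    show "\<iota> f \<in> carrier U" by (simp add: \<iota>_def U.eta_prod_closed index_list)
    \<comment> \<open>The two selectors are compared only at indices in \<open>I\<close>, hence the
      induction over lists inside \<open>I\<close> in place of an equality of functions.\<close>
    have "U.eta_prod xs (\<lambda>i. (f \<otimes>\<^bsub>?Z\<^esub> g) i = 1) = U.eta_prod xs (\<lambda>i. (f i = 1) \<noteq> (g i = 1))"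
      if "set xs \<subseteq> I" for xs
      using that
    proof (induction xs)
      case (Cons i xs)
      have "i \<in> I" "f i = 0 \<or> f i = 1" "g i = 0 \<or> g i = 1"
        using Cons.prems f g unfolding Z by auto
      then have "(f \<otimes>\<^bsub>?Z\<^esub> g) i = 1 \<longleftrightarrow> (f i = 1) \<noteq> (g i = 1)"
        by (elim disjE) (simp_all add: integer_mod_group_def)
      then show ?case using Cons by simp
    qed simp
    then show "\<iota> (f \<otimes>\<^bsub>?Z\<^esub> g) = \<iota> f \<otimes>\<^bsub>U\<^esub> \<iota> g"
      using index_list U.eta_prod_mult unfolding \<iota>_def by simp
  qed
  have "inj_on \<iota> (carrier ?Z)"
  proof (rule inj_onI)
    fix f g assume f: "f \<in> carrier ?Z" and g: "g \<in> carrier ?Z" and eq: "\<iota> f = \<iota> g"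
    show "f = g"
    proof (rule extensionalityI)
      show "f \<in> extensional I" "g \<in> extensional I" using f g Z by auto
      fix k assume k: "k \<in> I"
      have "f k = 0 \<or> f k = 1" "g k = 0 \<or> g k = 1" using f g k unfolding Z by auto
      then show "f k = g k" using eta_prod_inj[OF eq[unfolded \<iota>_def] k] by auto
    qed
  qed
  have img: "\<iota> ` carrier ?Z = N"
  proof
    show "\<iota> ` carrier ?Z \<subseteq> N" by (auto simp: \<iota>_def N_def)
    show "N \<subseteq> \<iota> ` carrier ?Z"
    proof
      fix x assume "x \<in> N"
      then obtain P where P: "x = U.eta_prod index_list P" by (auto simp: N_def)
      define f where "f = (\<lambda>i\<in>I. if P i then 1 else (0::int))"
      have "U.eta_prod xs P = U.eta_prod xs (\<lambda>i. f i = 1)" if "set xs \<subseteq> I" for xs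
        using that by (induction xs) (auto simp: f_def)
      then have "x = \<iota> f" using P index_list by (simp add: \<iota>_def)
      moreover have "f \<in> carrier ?Z" unfolding Z by (auto simp: f_def)
      ultimately show "x \<in> \<iota> ` carrier ?Z" by blast
    qed
  qed
  have surj: "\<pi> ` carrier U = carrier W"
  proof
    show "\<pi> ` carrier U \<subseteq> carrier W" using \<pi>_hom by (auto simp: hom_def)
    show "carrier W \<subseteq> \<pi> ` carrier U"
    proof
      fix x assume "x \<in> carrier W"
      then obtain w where w: "w \<in> group_words I" "x = W_class I a w"
        by (auto simp: W_def carrier_presented_group)
      have w': "map_word Sig w \<in> group_words (ugens I)"
        using w(1) by (rule map_word_in_group_words) auto
      have "map_word ugen_index (map_word Sig w) = w" by (induction w) auto
      then have "x = \<pi> (U_class I a (map_word Sig w))" using \<pi>[OF w'] w(2) by simp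
      then show "x \<in> \<pi> ` carrier U" using U_class_closed[OF w'] by blast
    qed
  qed
  have ker: "N = kernel U W \<pi>"
  proof
    interpret h: group_hom U W \<pi>
      using \<pi>_hom group_U group_W by (simp add: group_hom_def group_hom_axioms_def)
    have "\<pi> (U.eta_prod xs P) = \<one>\<^bsub>W\<^esub>" if "set xs \<subseteq> I" for xs P
      using that
    proof (induction xs)
      case (Cons i xs)
      have "\<pi> (U.eta i) = W_class I a [(i, True), (i, True)]"
        using Cons.prems by (simp add: U.eta_def U_class_mult \<pi>)
      also have "\<dots> = \<one>\<^bsub>W\<^esub>"
        using W_eq_square[of i I a] Cons.prems by (simp add: W_def one_presented_group word_class_eq_iff)
      finally show ?case using Cons by (simp add: U.eta_closed U.eta_prod_closed)
    qed simp
    then show "N \<subseteq> kernel U W \<pi>"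
      using index_list by (auto simp: N_def kernel_def U.eta_prod_closed)
    \<comment> \<open>If the word without bars is trivial in \<open>W\<close>, its lift through
      \<open>Sig\<close> lies in the trivial coset, and this lift has the same coset as the original
      word.\<close>
    show "kernel U W \<pi> \<subseteq> N"
    proof
      fix x assume "x \<in> kernel U W \<pi>"
      then have x: "x \<in> carrier U" "\<pi> x = \<one>\<^bsub>W\<^esub>" by (auto simp: kernel_def)
      obtain u where u: "u \<in> group_words (ugens I)" "x = U_class I a u"
        using x(1) by (auto simp: U_def carrier_presented_group)
      have "map_word ugen_index u \<in> group_words I"
        using u(1) by (rule map_word_in_group_words) auto
      then have "W_eq I a (map_word ugen_index u) []"
        using x(2) u \<pi>[OF u(1)] by (simp add: W_def one_presented_group word_class_eq_iff)
      from W_eq_imp_N_coset[OF this] have "N #>\<^bsub>U\<^esub> x = N #>\<^bsub>U\<^esub> \<one>\<^bsub>U\<^esub>"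
        using N_coset_ugen_index[OF u(1)] u(2) by (simp add: map_word_map_word U_class_Nil)
      then have "N #>\<^bsub>U\<^esub> x = N"
        using subgroup.subset[OF subgroup_N] by simp
      then show "x \<in> N" using U.coset_join1 subgroup_N x(1) subgroup.subset by metis
    qed
  qed
  have "short_exact ?Z U W \<iota> \<pi>"
    unfolding short_exact_def
  proof (intro conjI)
    show "group ?Z" by simp
    show "\<iota> \<in> mon ?Z U" using \<iota>_hom \<open>inj_on \<iota> (carrier ?Z)\<close> by (simp add: mon_def)
    show "\<pi> \<in> epi U W" using \<pi>_hom surj by (simp add: epi_def)
    show "\<iota> ` carrier ?Z = kernel U W \<pi>" using img ker by simp
  qed (rule group_U group_W)+
  then show ?thesis by blast
qed

end


theorem proposition4p1:
  fixes scale :: "complex \<Rightarrow> 'g::ab_group_add \<Rightarrow> 'g"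
    and br :: "'g \<Rightarrow> 'g \<Rightarrow> 'g"
    and I :: "'i set"
    and a :: "'i \<Rightarrow> 'i \<Rightarrow> int"
  assumes "complex_lie_algebra scale br"
    and "complex_lie_algebra.semisimple scale br"
    and "complex_lie_algebra.is_cartan_matrix scale br I a"
  shows "\<exists>\<iota> \<pi>. short_exact (product_group I (\<lambda>_. integer_mod_group 2))
           (weyl_group_U I a) (weyl_group I a) \<iota> \<pi>"
proof -
  interpret complex_lie_algebra scale br by fact
  interpret finite_type_matrix I a
    using cartan_matrix_entries[OF assms(3)] by unfold_locales
  show ?thesis by (rule short_exact_weyl_group_U)
qed

end
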